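(* Let $N\ge1$ and $I\ge2$ be integers, let $B$ be a set with $\{1\}\subseteq B\subseteq\{1,\ldots,\lfloor I/2\rfloor\}$, let $z_0\in\mathrm{dom}\,h$, let $D\ge d_0$ be an over-estimate of $d_0$, and define $$\lambda=\frac{D\sqrt{I+1}}{2M\sqrt{22N\log(I+1)}}.$$ Then the output $(y_N^a,w_N^a)$ of the method M-Max1C with input $(\lambda,I,N,B,z_0)$ satisfies $$\mathbb{E}[\phi(y_N^a)]-\phi_*\le\mathbb{E}[w_N^a]-\phi_*\le\frac{2\sqrt{\log(I+1)}}{\sqrt{I+1}}\left[\frac{\sqrt{22}\,MD}{\sqrt{N}}+2\sigma(x_* )\sqrt{|B|-1}\right].$$
   Context: Problem: $\phi_*:=\min\{\phi(x):=f(x)+h(x):x\in\mathbb{R}^n\}$ with $f(x)=\mathbb{E}_\xi[F(x,\xi)]$, where $\xi$ is a random vector with support $\Xi$. $\log$ is the natural logarithm, $\|\cdot\|$ the Euclidean norm, and $\mathrm{dom}\,\psi=\{x:\psi(x)<\infty\}$. Standing assumptions. (i) $f,h:\mathbb{R}^n\to\mathbb{R}\cup\{+\infty\}$ are proper closed convex functions with $\mathrm{dom}\,h\subseteq\mathrm{dom}\,f$. (ii) For almost every $\xi\in\Xi$ a convex function $F(\cdot,\xi):\mathrm{dom}\,h\to\mathbb{R}$ and a map $s(\cdot,\xi):\mathrm{dom}\,h\to\mathbb{R}^n$ are available such that for every $x\in\mathrm{dom}\,h$, $f(x)=\mathbb{E}[F(x,\xi)]$ and $s(x,\xi)\in\partial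 F(x,\xi)$, i.e. $F(u,\xi)\ge F(x,\xi)+\langle s(x,\xi),u-x\rangle$ for all $u\in\mathrm{dom}\,h$. (iii) $M:=\sup\{\mathbb{E}[\|s(x,\xi)\|^2]^{1/2}:x\in\mathrm{dom}\,h\}<\infty$. (iv) The set $X_*$ of minimizers of $\phi$ is nonempty. Notation. $\Phi(\cdot;\xi)=F(\cdot,\xi)+h(\cdot)$; $\ell(\cdot,x;\xi)=F(x,\xi)+h(\cdot)+\langle s(x,\xi),\cdot-x\rangle$; $\sigma(u)=\sqrt{\mathbb{E}[(\Phi(u;\xi)-\phi(u))^2]}$; $x_*:=\mathrm{argmin}\{\|z_0-x\|:x\in X_*\}$ and $d_0:=\|z_0-x_*\|$, where $z_0$ is the initial point of M-Max1C. The quantities are such that $\lambda$ is a well-defined positive number (i.e. $M>0$, $D>0$). All random quantities are measurable, the expectations are understood to be well defined, and $0\cdot\infty=0$. Method S-Max1C. Input: $\lambda>0$, integer $I\ge 2$, set $B$ with $\{1\}\subseteq B\subseteq\{1,\ldots,\lfloor I/2\rfloor\}$, $z_0\in\mathrm{dom}\,h$. Let $\beta=\frac{I+1-\log(I+1)}{I+1+\log(I+1)}$ and let $\xi_0,\xi_1,\ldots,\xi_I$ be independent samples of $\xi$. For $j=1,\ldots,I$: (1) $\Gamma_1(\cdot)=\ell(\cdot,z_0;\xi_0)$; for $j\ge2$ with $j\in B$, $\Gamma_j(\cdot)=(1-\beta)\ell(\cdot,z_{j-1};\xi_{j-1})+\beta\max\{\Gamma_{j-1}(\cdot),\ell(\cdot,z_{j-1};\xi_{j-1})\}$;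 for $j\ge 2$ with $j\notin B$, $\Gamma_j(\cdot)=(1-\beta)\ell(\cdot,z_{j-1};\xi_{j-1})+\beta\Gamma_{j-1}(\cdot)$; (2) $z_j=\mathrm{argmin}_{u\in\mathbb{R}^n}\{\Gamma_j(u)+\frac{1}{2\lambda}\|u-z_0\|^2\}$; (3) $z_1^a=z_1$ and $z_j^a=(1-\beta)z_j+\beta z_{j-1}^a$ for $j\ge2$; (4) $u_1=\Phi(z_1;\xi_1)$ and $u_j=(1-\beta)\Phi(z_j;\xi_j)+\beta u_{j-1}$ for $j\ge2$. Output: $(z_I,z_I^a,u_I)$. Method M-Max1C. Input: $\lambda>0$, integers $I\ge2$, $N\ge1$, set $B$ with $\{1\}\subseteq B\subseteq\{1,\ldots,\lfloor I/2\rfloor\}$, $z_0\in\mathrm{dom}\,h$. Set $x_0=z_0$; for $l=1,\ldots,N$ let $(x_l,y_l,w_l)$ be the output of S-Max1C with input $(\lambda,I,B,x_{l-1})$, where each call uses fresh samples independent of those of all previous calls. Output: $y_N^a=\frac1N\sum_{l=1}^N y_l$ and $w_N^a=\frac1N\sum_{l=1}^N w_l$. *)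

theory Defs
  imports "HOL-Probability.Probability"
begin

section \<open>Extended-real-valued convex functions\<close>

definition edom :: "('a \<Rightarrow> ereal) \<Rightarrow> 'a set" where
  "edom g = {x. g x < \<infinity>}"

definition ereal_epigraph :: "('a \<Rightarrow> ereal) \<Rightarrow> ('a \<times> real) set" where
  "ereal_epigraph g = {(x, r). g x \<le> ereal r}"

text \<open>Proper: never \<open>-\<infinity>\<close> and somewhere finite; closed and convex are read off the epigraph.\<close>

definition proper_closed_convex :: "('a::euclidean_space \<Rightarrow> ereal) \<Rightarrow> bool" where
  "proper_closed_convex g \<longleftrightarrow>
     (\<forall>x. g x \<noteq> -\<infinity>) \<and> edom g \<noteq> {} \<and>
     closed (ereal_epigraph g) \<and> convex (ereal_epigraph g)"


section \<open>Extended expectation\<close>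

text \<open>
  The expectation of an extended-real random variable, as the expectation of its positive part
  minus that of its negative part. On \<^typ>\<open>ereal\<close> one has \<open>\<infinity> - \<infinity> = \<infinity>\<close>, so \<open>expect M X < \<infinity>\<close>
  implies that the positive part has finite expectation: unlike for the Bochner integral, an
  undefined expectation cannot satisfy a finite upper bound. For an integrable real-valued
  variable this is the usual integral.
\<close>

definition expect :: "'w measure \<Rightarrow> ('w \<Rightarrow> ereal) \<Rightarrow> ereal" where
  "expect M X =
     enn2ereal (\<integral>\<^sup>+\<omega>. e2ennreal (X \<omega>) \<partial>M) - enn2ereal (\<integral>\<^sup>+\<omega>. e2ennreal (- X \<omega>) \<partial>M)"

text \<open>Only used at nonnegative arguments.\<close>

definition ereal_sqrt :: "ereal \<Rightarrow> ereal" where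
  "ereal_sqrt x = (case x of ereal r \<Rightarrow> ereal (sqrt r) | PInfty \<Rightarrow> \<infinity> | MInfty \<Rightarrow> -\<infinity>)"


section \<open>The stochastic composite problem\<close>

text \<open>
  Throughout, \<open>Q\<close> is the law of \<open>\<xi>\<close> (with \<open>space Q\<close> the support), \<open>F x \<xi>\<close> and \<open>s x \<xi>\<close> are the
  stochastic function value and subgradient; only their values for \<open>x \<in> edom h\<close> matter.
\<close>

definition phi :: "('a \<Rightarrow> ereal) \<Rightarrow> ('a \<Rightarrow> ereal) \<Rightarrow> 'a \<Rightarrow> ereal" where
  "phi f h x = f x + h x"

definition phi_opt :: "('a \<Rightarrow> ereal) \<Rightarrow> ('a \<Rightarrow> ereal) \<Rightarrow> ereal" where
  "phi_opt f h = (INF x. phi f h x)"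

definition minimizers :: "('a \<Rightarrow> ereal) \<Rightarrow> ('a \<Rightarrow> ereal) \<Rightarrow> 'a set" where
  "minimizers f h = {x. \<forall>y. phi f h x \<le> phi f h y}"

definition Phi :: "('a \<Rightarrow> ereal) \<Rightarrow> ('a \<Rightarrow> 'b \<Rightarrow> real) \<Rightarrow> 'a \<Rightarrow> 'b \<Rightarrow> ereal" where
  "Phi h F u \<xi> = ereal (F u \<xi>) + h u"

definition lin ::
  "('a::euclidean_space \<Rightarrow> ereal) \<Rightarrow> ('a \<Rightarrow> 'b \<Rightarrow> real) \<Rightarrow> ('a \<Rightarrow> 'b \<Rightarrow> 'a) \<Rightarrow> 'a \<Rightarrow> 'b \<Rightarrow> 'a \<Rightarrow> ereal"
where
  "lin h F s x \<xi> u = ereal (F x \<xi>) + h u + ereal (s x \<xi> \<bullet> (u - x))"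

definition noise_bound ::
  "'b measure \<Rightarrow> ('a::euclidean_space \<Rightarrow> ereal) \<Rightarrow> ('a \<Rightarrow> 'b \<Rightarrow> 'a) \<Rightarrow> ereal" where
  "noise_bound Q h s = (SUP x\<in>edom h. ereal_sqrt (expect Q (\<lambda>\<xi>. ereal ((norm (s x \<xi>))\<^sup>2))))"

definition sigma ::
  "'b measure \<Rightarrow> ('a \<Rightarrow> ereal) \<Rightarrow> ('a \<Rightarrow> ereal) \<Rightarrow> ('a \<Rightarrow> 'b \<Rightarrow> real) \<Rightarrow> 'a \<Rightarrow> ereal" where
  "sigma Q f h F u = ereal_sqrt (expect Q (\<lambda>\<xi>. (Phi h F u \<xi> - phi f h u)\<^sup>2))"


section \<open>The method S-Max1C\<close>

definition beta :: "nat \<Rightarrow> real" where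
  "beta I = (real I + 1 - ln (real I + 1)) / (real I + 1 + ln (real I + 1))"

definition prox_step :: "real \<Rightarrow> 'a::euclidean_space \<Rightarrow> ('a \<Rightarrow> ereal) \<Rightarrow> 'a" where
  "prox_step lam z0 G = (ARG_MIN (\<lambda>u. G u + ereal ((norm (u - z0))\<^sup>2 / (2 * lam))) u. True)"

text \<open>
  The methods are functions of the sample path: \<open>w j\<close> is the value of the sample \<open>\<xi>\<^sub>j\<close>. The
  models \<open>\<Gamma>\<^sub>j\<close> and the sequences \<open>z\<^sup>a\<^sub>j\<close>, \<open>u\<^sub>j\<close> start at \<open>j = 1\<close>; their values at
  \<open>j = 0\<close> are placeholders which no later value depends on.
\<close>

fun smax_model ::
  "('a::euclidean_space \<Rightarrow> ereal) \<Rightarrow> ('a \<Rightarrow> 'b \<Rightarrow> real) \<Rightarrow> ('a \<Rightarrow> 'b \<Rightarrow> 'a) \<Rightarrow> real \<Rightarrow> nat \<Rightarrow>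
    nat set \<Rightarrow> 'a \<Rightarrow> (nat \<Rightarrow> 'b) \<Rightarrow> nat \<Rightarrow> 'a \<Rightarrow> ereal"
where
  "smax_model h F s lam I B z0 w 0 = h"
| "smax_model h F s lam I B z0 w (Suc 0) = lin h F s z0 (w 0)"
| "smax_model h F s lam I B z0 w (Suc (Suc i)) =
     (let j = Suc (Suc i);
          G = smax_model h F s lam I B z0 w (j - 1);
          z = prox_step lam z0 G;
          l = lin h F s z (w (j - 1))
      in if j \<in> B
         then (\<lambda>u. ereal (1 - beta I) * l u + ereal (beta I) * max (G u) (l u))
         else (\<lambda>u. ereal (1 - beta I) * l u + ereal (beta I) * G u))"

definition smax_z ::
  "('a::euclidean_space \<Rightarrow> ereal) \<Rightarrow> ('a \<Rightarrow> 'b \<Rightarrow> real) \<Rightarrow> ('a \<Rightarrow> 'b \<Rightarrow> 'a) \<Rightarrow> real \<Rightarrow> nat \<Rightarrow>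
    nat set \<Rightarrow> 'a \<Rightarrow> (nat \<Rightarrow> 'b) \<Rightarrow> nat \<Rightarrow> 'a"
where
  "smax_z h F s lam I B z0 w j =
     (if j = 0 then z0 else prox_step lam z0 (smax_model h F s lam I B z0 w j))"

fun smax_za ::
  "('a::euclidean_space \<Rightarrow> ereal) \<Rightarrow> ('a \<Rightarrow> 'b \<Rightarrow> real) \<Rightarrow> ('a \<Rightarrow> 'b \<Rightarrow> 'a) \<Rightarrow> real \<Rightarrow> nat \<Rightarrow>
    nat set \<Rightarrow> 'a \<Rightarrow> (nat \<Rightarrow> 'b) \<Rightarrow> nat \<Rightarrow> 'a"
where
  "smax_za h F s lam I B z0 w 0 = z0"
| "smax_za h F s lam I B z0 w (Suc 0) = smax_z h F s lam I B z0 w 1"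
| "smax_za h F s lam I B z0 w (Suc (Suc i)) =
     (1 - beta I) *\<^sub>R smax_z h F s lam I B z0 w (Suc (Suc i)) +
     beta I *\<^sub>R smax_za h F s lam I B z0 w (Suc i)"

fun smax_u ::
  "('a::euclidean_space \<Rightarrow> ereal) \<Rightarrow> ('a \<Rightarrow> 'b \<Rightarrow> real) \<Rightarrow> ('a \<Rightarrow> 'b \<Rightarrow> 'a) \<Rightarrow> real \<Rightarrow> nat \<Rightarrow>
    nat set \<Rightarrow> 'a \<Rightarrow> (nat \<Rightarrow> 'b) \<Rightarrow> nat \<Rightarrow> ereal"
where
  "smax_u h F s lam I B z0 w 0 = 0"
| "smax_u h F s lam I B z0 w (Suc 0) = Phi h F (smax_z h F s lam I B z0 w 1) (w 1)"
| "smax_u h F s lam I B z0 w (Suc (Suc i)) =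
     ereal (1 - beta I) * Phi h F (smax_z h F s lam I B z0 w (Suc (Suc i))) (w (Suc (Suc i))) +
     ereal (beta I) * smax_u h F s lam I B z0 w (Suc i)"


section \<open>The method M-Max1C\<close>

text \<open>\<open>W l j\<close> is the value of the \<open>j\<close>-th sample in the \<open>l\<close>-th call of S-Max1C, \<open>l \<ge> 1\<close>.\<close>

primrec mmax_x ::
  "('a::euclidean_space \<Rightarrow> ereal) \<Rightarrow> ('a \<Rightarrow> 'b \<Rightarrow> real) \<Rightarrow> ('a \<Rightarrow> 'b \<Rightarrow> 'a) \<Rightarrow> real \<Rightarrow> nat \<Rightarrow>
    nat set \<Rightarrow> 'a \<Rightarrow> (nat \<Rightarrow> nat \<Rightarrow> 'b) \<Rightarrow> nat \<Rightarrow> 'a"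
where
  "mmax_x h F s lam I B z0 W 0 = z0"
| "mmax_x h F s lam I B z0 W (Suc l) =
     smax_z h F s lam I B (mmax_x h F s lam I B z0 W l) (W (Suc l)) I"

definition mmax_y ::
  "('a::euclidean_space \<Rightarrow> ereal) \<Rightarrow> ('a \<Rightarrow> 'b \<Rightarrow> real) \<Rightarrow> ('a \<Rightarrow> 'b \<Rightarrow> 'a) \<Rightarrow> real \<Rightarrow> nat \<Rightarrow>
    nat set \<Rightarrow> 'a \<Rightarrow> (nat \<Rightarrow> nat \<Rightarrow> 'b) \<Rightarrow> nat \<Rightarrow> 'a"
where
  "mmax_y h F s lam I B z0 W l =
     smax_za h F s lam I B (mmax_x h F s lam I B z0 W (l - 1)) (W l) I"

definition mmax_w ::
  "('a::euclidean_space \<Rightarrow> ereal) \<Rightarrow> ('a \<Rightarrow> 'b \<Rightarrow> real) \<Rightarrow> ('a \<Rightarrow> 'b \<Rightarrow> 'a) \<Rightarrow> real \<Rightarrow> nat \<Rightarrow>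
    nat set \<Rightarrow> 'a \<Rightarrow> (nat \<Rightarrow> nat \<Rightarrow> 'b) \<Rightarrow> nat \<Rightarrow> ereal"
where
  "mmax_w h F s lam I B z0 W l =
     smax_u h F s lam I B (mmax_x h F s lam I B z0 W (l - 1)) (W l) I"

definition mmax_ya ::
  "('a::euclidean_space \<Rightarrow> ereal) \<Rightarrow> ('a \<Rightarrow> 'b \<Rightarrow> real) \<Rightarrow> ('a \<Rightarrow> 'b \<Rightarrow> 'a) \<Rightarrow> real \<Rightarrow> nat \<Rightarrow>
    nat \<Rightarrow> nat set \<Rightarrow> 'a \<Rightarrow> (nat \<Rightarrow> nat \<Rightarrow> 'b) \<Rightarrow> 'a"
where
  "mmax_ya h F s lam I N B z0 W =
     (1 / real N) *\<^sub>R (\<Sum>l=1..N. mmax_y h F s lam I B z0 W l)"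

definition mmax_wa ::
  "('a::euclidean_space \<Rightarrow> ereal) \<Rightarrow> ('a \<Rightarrow> 'b \<Rightarrow> real) \<Rightarrow> ('a \<Rightarrow> 'b \<Rightarrow> 'a) \<Rightarrow> real \<Rightarrow> nat \<Rightarrow>
    nat \<Rightarrow> nat set \<Rightarrow> 'a \<Rightarrow> (nat \<Rightarrow> nat \<Rightarrow> 'b) \<Rightarrow> ereal"
where
  "mmax_wa h F s lam I N B z0 W =
     ereal (1 / real N) * (\<Sum>l=1..N. mmax_w h F s lam I B z0 W l)"

end

theory Submission
  imports Defs
begin

text \<open>
  Fix a minimizer \<open>u\<close> of \<open>\<phi>\<close> and let \<open>t = ln (I + 1) / (I + 1)\<close>.

  Consider one call with centre \<open>x\<^sub>0\<close>. Whether or not the maximum is used, a model dominates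
  \<open>(1 - \<beta>)\<close> times the newest cut plus \<open>\<beta>\<close> times the previous model, and the objective of a proximal
  step grows quadratically away from its minimizer. Hence the optimal values of the proximal
  subproblems obey the recursion of the running average of the objective values, up to a penalty
  per step: a mean-zero sampling error and a multiple of \<open>\<lambda> (M + \<bar>s\<bar>)\<^sup>2\<close>, which is what remains
  after the quadratic growth absorbs the move between two iterates (\<open>values_le_model_min\<close>). On the
  other side the last optimal value is at most the model at \<open>u\<close> plus the difference of two squared
  distances, and the model at \<open>u\<close> exceeds \<open>\<phi> u\<close> only by accumulated noise. Together these give
  \<open>path_inequality\<close>, which holds for almost every sample path.

  In expectation the sampling errors vanish because an iterate is independent of the sample paired
  with it (\<open>joint_law_determined\<close>, \<open>integral_independent_sample\<close>); this needs the iterates to be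
  measurable, which follows from the measurability of proximal points
  (\<open>borel_measurable_prox_step\<close>). The penalties sum to at most \<open>14 t \<lambda> M\<^sup>2\<close>. Only the steps that use the
  maximum make the noise at \<open>u\<close> have positive mean. They all lie in the first half of the call,
  where the second moment of the noise is at most \<open>|B| \<sigma>\<^sup>2\<close>, and the second half shrinks the mean by
  \<open>\<beta>\<^bsup>I/2\<^esup>\<close>, which is at most a constant times \<open>sqrt t\<close> (\<open>expected_noise_le\<close>).

  Over the restarts the squared distances to \<open>u\<close> telescope (\<open>sum_values_le\<close>), and the choice of \<open>\<lambda>\<close>
  makes the initial distance and the penalties each contribute at most half of the first term of
  the bound (\<open>step_size_balance\<close>). The average output point has no larger objective value than the
  average of the values, by convexity, and sampling the values does not change their mean.
\<close>



section \<open>Closed convex functions and proximal points\<close>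

lemma ereal_real_pcc:
  assumes "proper_closed_convex k" "x \<in> edom k"
  shows "ereal (real_of_ereal (k x)) = k x"
  using assms unfolding proper_closed_convex_def edom_def
  by (intro ereal_real') (auto simp: )

lemma edom_real_add: "edom (\<lambda>u. ereal (g u) + h u) = edom h"
proof -
  have "(ereal (g u) + h u < \<infinity>) = (h u < \<infinity>)" for u
    by (cases "h u") auto
  then show ?thesis by (simp add: edom_def)
qed

lemma pcc_real_add:
  fixes h :: "'a::euclidean_space \<Rightarrow> ereal"
  assumes h: "proper_closed_convex h" and g: "convex_on UNIV g"
  shows "proper_closed_convex (\<lambda>u. ereal (g u) + h u)"
proof -
  have cont: "continuous_on UNIV g"
    using convex_on_continuous[OF open_UNIV g] .
  have epi: "ereal_epigraph (\<lambda>u. ereal (g u) + h u) = (\<lambda>(u, r). (u, r - g u)) -` ereal_epigraph h"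
  proof -
    have "(ereal (g u) + h u \<le> ereal r) = (h u \<le> ereal (r - g u))" for u r
      using h unfolding proper_closed_convex_def by (cases "h u") (auto simp: algebra_simps)
    then show ?thesis by (auto simp: ereal_epigraph_def)
  qed
  have "closed (ereal_epigraph (\<lambda>u. ereal (g u) + h u))"
    unfolding epi case_prod_unfold
  proof (rule closed_vimage)
    show "closed (ereal_epigraph h)" using h by (simp add: proper_closed_convex_def)
    show "continuous_on UNIV (\<lambda>p. (fst p, snd p - g (fst p)))"
      by (intro continuous_intros continuous_on_compose2[OF cont]) auto
  qed
  moreover have "convex (ereal_epigraph (\<lambda>u. ereal (g u) + h u))"
  proof (rule convexI, clarsimp simp: epi)
    fix x a y b and p q :: real
    assume xa: "(x, a - g x) \<in> ereal_epigraph h" and yb: "(y, b - g y) \<in> ereal_epigraph h"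
      and pq: "0 \<le> p" "0 \<le> q" "p + q = 1"
    have "p *\<^sub>R (x, a - g x) + q *\<^sub>R (y, b - g y) \<in> ereal_epigraph h"
      using h xa yb pq unfolding proper_closed_convex_def by (intro convexD) auto
    then have "h (p *\<^sub>R x + q *\<^sub>R y) \<le> ereal (p * (a - g x) + q * (b - g y))"
      by (simp add: ereal_epigraph_def)
    also have "\<dots> \<le> ereal (p * a + q * b - g (p *\<^sub>R x + q *\<^sub>R y))"
      using g pq unfolding convex_on_def by (simp add: algebra_simps)
    finally show "(p *\<^sub>R x + q *\<^sub>R y, p * a + q * b - g (p *\<^sub>R x + q *\<^sub>R y)) \<in> ereal_epigraph h"
      by (simp add: ereal_epigraph_def)
  qed
  moreover have "ereal (g x) + h x \<noteq> -\<infinity>" for x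
    using h unfolding proper_closed_convex_def by (cases "h x") auto
  ultimately show ?thesis
    using h unfolding proper_closed_convex_def by (auto simp: edom_real_add)
qed

lemma closed_sublevel_pcc:
  fixes k :: "'a::euclidean_space \<Rightarrow> ereal"
  assumes k: "proper_closed_convex k"
  shows "closed {x. k x \<le> c}"
proof (cases c)
  case (real r)
  have "{x. k x \<le> c} = (\<lambda>x. (x, r)) -` ereal_epigraph k"
    by (auto simp: real ereal_epigraph_def)
  then show ?thesis
    using k unfolding proper_closed_convex_def
    by (auto intro!: continuous_closed_vimage continuous_intros)
next
  case MInf
  then have "{x. k x \<le> c} = {}"
    using k unfolding proper_closed_convex_def by auto
  then show ?thesis by simp
qed auto

lemma borel_measurable_pcc:
  fixes k :: "'a::euclidean_space \<Rightarrow> ereal"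
  assumes k: "proper_closed_convex k"
  shows "k \<in> borel_measurable borel"
proof (subst borel_measurable_iff_Iic_ereal, intro allI)
  fix c
  have "k -` {..c} \<inter> space borel = {x. k x \<le> c}" by auto
  then show "k -` {..c} \<inter> space borel \<in> sets borel"
    using closed_sublevel_pcc[OF k, of c] by auto
qed

lemma convex_on_max:
  assumes "convex_on S a" "convex_on S b"
  shows "convex_on S (\<lambda>x. max (a x) (b x))"
proof (rule convex_onI)
  show "convex S" using assms by (simp add: convex_on_def)
next
  fix t :: real and x y assume t: "0 < t" "t < 1" and xy: "x \<in> S" "y \<in> S"
  have "a ((1 - t) *\<^sub>R x + t *\<^sub>R y) \<le> (1 - t) * a x + t * a y"
    "b ((1 - t) *\<^sub>R x + t *\<^sub>R y) \<le> (1 - t) * b x + t * b y"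
    using t xy by (auto intro!: convex_onD assms)
  moreover have "(1 - t) * a x + t * a y \<le> (1 - t) * max (a x) (b x) + t * max (a y) (b y)"
    "(1 - t) * b x + t * b y \<le> (1 - t) * max (a x) (b x) + t * max (a y) (b y)"
    using t by (auto intro!: add_mono mult_left_mono)
  ultimately show "max (a ((1 - t) *\<^sub>R x + t *\<^sub>R y)) (b ((1 - t) *\<^sub>R x + t *\<^sub>R y))
      \<le> (1 - t) * max (a x) (b x) + t * max (a y) (b y)" by linarith
qed

lemma convex_on_pcc:
  fixes k :: "'a::euclidean_space \<Rightarrow> ereal"
  assumes k: "proper_closed_convex k"
  shows "convex_on (edom k) (\<lambda>x. real_of_ereal (k x))"
proof -
  have main: "p *\<^sub>R x + q *\<^sub>R y \<in> edom k \<and>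
      real_of_ereal (k (p *\<^sub>R x + q *\<^sub>R y)) \<le> p * real_of_ereal (k x) + q * real_of_ereal (k y)"
    if xy: "x \<in> edom k" "y \<in> edom k" and pq: "0 \<le> p" "0 \<le> q" "p + q = 1" for x y p q
  proof -
    have "(x, real_of_ereal (k x)) \<in> ereal_epigraph k" "(y, real_of_ereal (k y)) \<in> ereal_epigraph k"
      using ereal_real_pcc[OF k] xy by (auto simp: ereal_epigraph_def)
    then have "p *\<^sub>R (x, real_of_ereal (k x)) + q *\<^sub>R (y, real_of_ereal (k y)) \<in> ereal_epigraph k"
      using k pq unfolding proper_closed_convex_def by (intro convexD) auto
    then have le: "k (p *\<^sub>R x + q *\<^sub>R y) \<le> ereal (p * real_of_ereal (k x) + q * real_of_ereal (k y))"
      by (simp add: ereal_epigraph_def)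
    then have "p *\<^sub>R x + q *\<^sub>R y \<in> edom k"
      by (auto simp: edom_def intro: le_less_trans)
    with le show ?thesis
      using ereal_real_pcc[OF k, of "p *\<^sub>R x + q *\<^sub>R y"] by (metis ereal_less_eq(3))
  qed
  then have "convex (edom k)" by (auto intro!: convexI)
  with main show ?thesis
    unfolding convex_on_def by auto
qed

text \<open>
  The sublevel sets through the values of \<open>k\<close> on the compact set are nested closed sets, so their
  intersection with it is nonempty by compactness; any point of it is a minimum.
\<close>

lemma compact_attains_min_closed_sublevels:
  fixes k :: "'a::heine_borel \<Rightarrow> ereal"
  assumes K: "compact K" "K \<noteq> {}" and closed: "\<And>c. closed {x. k x \<le> c}"
  shows "\<exists>x\<in>K. \<forall>y\<in>K. k x \<le> k y"
proof -
  have "K \<inter> \<Inter>((\<lambda>y. {x. k x \<le> k y}) ` K) \<noteq> {}"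
  proof (rule compact_imp_fip[OF K(1)])
    fix G assume G: "finite G" "G \<subseteq> (\<lambda>y. {x. k x \<le> k y}) ` K"
    then obtain Y where Y: "Y \<subseteq> K" "finite Y" "G = (\<lambda>y. {x. k x \<le> k y}) ` Y"
      by (meson finite_subset_image)
    show "K \<inter> \<Inter>G \<noteq> {}"
    proof (cases "Y = {}")
      case False
      with Y have "Min (k ` Y) \<in> k ` Y" by (intro Min_in) auto
      then obtain y where "y \<in> Y" "k y = Min (k ` Y)" by auto
      moreover from this Y have "\<forall>y'\<in>Y. k y \<le> k y'" by auto
      ultimately show ?thesis using Y by auto
    qed (use Y K in auto)
  qed (use closed in auto)
  then show ?thesis by auto
qed

lemma sq_norm_convex_combination:
  fixes u v c :: "'a::euclidean_space"
  shows "(norm ((1 - t) *\<^sub>R u + t *\<^sub>R v - c))\<^sup>2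
    = (1 - t) * (norm (u - c))\<^sup>2 + t * (norm (v - c))\<^sup>2 - t * (1 - t) * (norm (u - v))\<^sup>2"
  unfolding power2_norm_eq_inner
  by (simp add: algebra_simps inner_commute power2_eq_square)

text \<open>
  The objective of a proximal step is strongly convex. Strong convexity along the segment from a
  fixed point \<open>u0\<close> to a point far away makes the objective there exceed its value at \<open>u0\<close>, so a
  minimum over a large enough ball is global; along the segment from a minimizer it gives the
  quadratic growth.
\<close>

lemma prox_step_growth:
  fixes k :: "'a::euclidean_space \<Rightarrow> ereal" and c :: 'a
  assumes k: "proper_closed_convex k" and lam: "0 < lam"
  defines "z \<equiv> prox_step lam c k"
  shows "z \<in> edom k"
    and "u \<in> edom k \<Longrightarrow>
      real_of_ereal (k z) + (norm (z - c))\<^sup>2 / (2 * lam) + (norm (u - z))\<^sup>2 / (2 * lam)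
        \<le> real_of_ereal (k u) + (norm (u - c))\<^sup>2 / (2 * lam)"
proof -
  define q where "q u = (norm (u - c))\<^sup>2 / (2 * lam)" for u
  define r where "r u = real_of_ereal (k u) + q u" for u
  let ?psi = "\<lambda>u. ereal (q u) + k u"
  have q_comb: "q ((1 - t) *\<^sub>R u + t *\<^sub>R v) =
      (1 - t) * q u + t * q v - t * (1 - t) * ((norm (u - v))\<^sup>2 / (2 * lam))" for t u v
    unfolding q_def sq_norm_convex_combination using lam by (simp add: field_simps)
  have "convex_on UNIV q"
  proof (rule convex_onI)
    fix m :: real and x y :: 'a assume "0 < m" "m < 1"
    then have "0 \<le> m * (1 - m) * ((norm (x - y))\<^sup>2 / (2 * lam))"
      using lam by auto
    then show "q ((1 - m) *\<^sub>R x + m *\<^sub>R y) \<le> (1 - m) * q x + m * q y"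
      unfolding q_comb by linarith
  qed simp
  then have psi: "proper_closed_convex ?psi"
    by (rule pcc_real_add[OF k])
  have psi_r: "?psi u = ereal (r u)" if "u \<in> edom k" for u
    using ereal_real_pcc[OF k that] by (cases "k u") (auto simp: r_def)
  have conv: "convex_on (edom k) (\<lambda>x. real_of_ereal (k x))"
    by (rule convex_on_pcc[OF k])
  then have edom_convex: "convex (edom k)" by (simp add: convex_on_def)
  have strong: "(1 - t) *\<^sub>R u + t *\<^sub>R v \<in> edom k \<and> r ((1 - t) *\<^sub>R u + t *\<^sub>R v) \<le>
      (1 - t) * r u + t * r v - t * (1 - t) * ((norm (u - v))\<^sup>2 / (2 * lam))"
    if "u \<in> edom k" "v \<in> edom k" "0 \<le> t" "t \<le> 1" for u v t
  proof -
    have "real_of_ereal (k ((1 - t) *\<^sub>R u + t *\<^sub>R v)) \<le>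
        (1 - t) * real_of_ereal (k u) + t * real_of_ereal (k v)"
      using that by (intro convex_onD[OF conv]) auto
    moreover have "(1 - t) *\<^sub>R u + t *\<^sub>R v \<in> edom k"
      using edom_convex that by (auto simp: convex_alt)
    ultimately show ?thesis
      unfolding r_def q_comb by (simp add: algebra_simps)
  qed
  obtain u0 where u0: "u0 \<in> edom k"
    using k unfolding proper_closed_convex_def by auto
  obtain v0 where v0: "v0 \<in> cball u0 1" "\<forall>y\<in>cball u0 1. ?psi v0 \<le> ?psi y"
    using compact_attains_min_closed_sublevels[of "cball u0 1" ?psi] closed_sublevel_pcc[OF psi]
    by auto
  have v0_dom: "v0 \<in> edom k"
  proof -
    have "?psi v0 \<le> ereal (r u0)" using v0(2)[rule_format, of u0] by (simp only: psi_r[OF u0] mem_cball) simp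
    then show ?thesis by (cases "k v0") (auto simp: edom_def)
  qed
  define \<rho> where "\<rho> = 1 + 2 * lam * (r u0 - r v0)"
  have r_v0: "r v0 \<le> r u0" using v0(2)[rule_format, of u0] psi_r u0 v0_dom by auto
  have \<rho>1: "1 \<le> \<rho>" using r_v0 lam by (simp add: \<rho>_def)
  obtain m where m: "m \<in> cball u0 \<rho>" "\<forall>y\<in>cball u0 \<rho>. ?psi m \<le> ?psi y"
    using compact_attains_min_closed_sublevels[of "cball u0 \<rho>" ?psi] closed_sublevel_pcc[OF psi] \<rho>1
    by auto
  have m_dom: "m \<in> edom k"
  proof -
    have "?psi m \<le> ereal (r u0)" using m(2)[rule_format, of u0] psi_r[OF u0] \<rho>1 by auto
    then show ?thesis by (cases "k m") (auto simp: edom_def)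
  qed
  have m_min: "?psi m \<le> ?psi u" for u
  proof (cases "u \<in> cball u0 \<rho>")
    case False
    show ?thesis
    proof (cases "u \<in> edom k")
      case True
      define d where "d = norm (u0 - u)"
      have d: "\<rho> < d" using False by (auto simp: d_def dist_norm)
      then have d1: "1 < d" using \<rho>1 by simp
      \<comment> \<open>the point at distance 1 from \<open>u0\<close> on the segment to \<open>u\<close>\<close>
      define y where "y = (1 - 1 / d) *\<^sub>R u0 + (1 / d) *\<^sub>R u"
      have y: "y \<in> edom k"
        "r y \<le> (1 - 1 / d) * r u0 + 1 / d * r u - 1 / d * (1 - 1 / d) * (d\<^sup>2 / (2 * lam))"
        using strong[OF u0 True, of "1 / d"] d1 by (simp_all add: y_def flip: d_def)
      have "u0 - y = (1 / d) *\<^sub>R (u0 - u)" by (simp add: y_def algebra_simps)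
      then have "norm (u0 - y) = 1" using d1 by (simp flip: d_def)
      then have "r v0 \<le> r y"
        using v0(2)[rule_format, of y] psi_r[OF v0_dom] psi_r[OF y(1)] by (auto simp: dist_norm)
      also note y(2)
      finally have "d * r v0 \<le> d * ((1 - 1 / d) * r u0 + 1 / d * r u - 1 / d * (1 - 1 / d) * (d\<^sup>2 / (2 * lam)))"
        using d1 by (intro mult_left_mono) auto
      also have "\<dots> = (d - 1) * r u0 + r u - d * ((d - 1) / (2 * lam))"
        using d1 lam by (simp add: field_simps power2_eq_square)
      finally have "r u0 + d * ((d - 1) / (2 * lam) - (r u0 - r v0)) \<le> r u"
        by (simp add: algebra_simps)
      moreover have "r u0 - r v0 \<le> (d - 1) / (2 * lam)"
        using d lam by (simp add: \<rho>_def field_simps)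
      then have "0 \<le> d * ((d - 1) / (2 * lam) - (r u0 - r v0))"
        using d1 by (intro mult_nonneg_nonneg) auto
      ultimately have "r u0 \<le> r u" by linarith
      moreover have "r m \<le> r u0"
        using m(2)[rule_format, of u0] psi_r u0 m_dom \<rho>1 by auto
      ultimately show ?thesis using psi_r True m_dom by auto
    qed (auto simp: edom_def)
  qed (use m in auto)
  have "is_arg_min (\<lambda>u. k u + ereal ((norm (u - c))\<^sup>2 / (2 * lam))) (\<lambda>_. True) m"
    using m_min by (auto simp: is_arg_min_def q_def not_less add.commute)
  then have "is_arg_min (\<lambda>u. k u + ereal ((norm (u - c))\<^sup>2 / (2 * lam))) (\<lambda>_. True) z"
    unfolding z_def prox_step_def arg_min_def by (rule someI)
  then have z_min: "?psi z \<le> ?psi u" for u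
    by (auto simp: is_arg_min_def q_def not_less add.commute)
  show z: "z \<in> edom k"
    using z_min[of u0] psi_r[OF u0] by (cases "k z") (auto simp: edom_def)
  show "real_of_ereal (k z) + (norm (z - c))\<^sup>2 / (2 * lam) + (norm (u - z))\<^sup>2 / (2 * lam)
      \<le> real_of_ereal (k u) + (norm (u - c))\<^sup>2 / (2 * lam)" if u: "u \<in> edom k"
  proof -
    define a where "a = (norm (z - u))\<^sup>2 / (2 * lam)"
    have growth: "(1 - t) * a \<le> r u - r z" if t: "0 < t" "t < 1" for t
    proof -
      have "(1 - t) *\<^sub>R z + t *\<^sub>R u \<in> edom k"
        "r ((1 - t) *\<^sub>R z + t *\<^sub>R u) \<le> (1 - t) * r z + t * r u - t * (1 - t) * a"
        using strong[OF z u, of t] t by (auto simp: a_def)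
      moreover from this have "r z \<le> r ((1 - t) *\<^sub>R z + t *\<^sub>R u)"
        using z_min[of "(1 - t) *\<^sub>R z + t *\<^sub>R u"] psi_r z by auto
      ultimately have "r z \<le> (1 - t) * r z + t * r u - t * (1 - t) * a" by linarith
      then have "t * ((1 - t) * a) \<le> t * (r u - r z)"
        by (simp add: algebra_simps)
      then show ?thesis using t by simp
    qed
    have "a \<le> r u - r z"
    proof (rule tendsto_upperbound)
      show "((\<lambda>t. (1 - t) * a) \<longlongrightarrow> a) (at_right (0::real))"
        by (rule tendsto_eq_intros refl | simp)+
      show "eventually (\<lambda>t. (1 - t) * a \<le> r u - r z) (at_right (0::real))"
        unfolding eventually_at_right_field using growth by (intro exI[of _ 1]) auto
    qed simp
    then show ?thesis by (simp add: a_def r_def q_def norm_minus_commute)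
  qed
qed

text \<open>
  Only countably many trial points are needed: the graph of \<open>h\<close> over its domain is separable, and
  the part of the objective that depends on the parameter is continuous. The first trial point
  whose value is within \<open>1 / Suc m\<close> of all others depends measurably on the parameter, and by
  quadratic growth these points converge to the minimizer.
\<close>

lemma borel_measurable_prox_step:
  fixes h :: "'a::euclidean_space \<Rightarrow> ereal" and c :: "'p \<Rightarrow> 'a"
  assumes h: "proper_closed_convex h" and lam: "0 < lam"
    and convex: "\<And>p. p \<in> space N \<Longrightarrow> convex_on UNIV (g p)"
    and meas: "\<And>u. (\<lambda>p. g p u) \<in> borel_measurable N"
    and c: "c \<in> borel_measurable N"
  shows "(\<lambda>p. prox_step lam (c p) (\<lambda>u. ereal (g p u) + h u)) \<in> borel_measurable N"
proof -
  define H where "H u = real_of_ereal (h u)" for u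
  define \<psi> where "\<psi> p u = g p u + H u + (norm (u - c p))\<^sup>2 / (2 * lam)" for p u
  define z where "z p = prox_step lam (c p) (\<lambda>u. ereal (g p u) + h u)" for p
  have real_eq: "real_of_ereal (ereal (g p u) + h u) = g p u + H u" if "u \<in> edom h" for p u
    using ereal_real_pcc[OF h that] by (cases "h u") (auto simp: H_def)
  have z_dom: "z p \<in> edom h"
    and growth: "\<And>u. u \<in> edom h \<Longrightarrow> \<psi> p (z p) + (norm (u - z p))\<^sup>2 / (2 * lam) \<le> \<psi> p u"
    if p: "p \<in> space N" for p
  proof -
    have pcc: "proper_closed_convex (\<lambda>u. ereal (g p u) + h u)"
      by (rule pcc_real_add[OF h convex[OF p]])
    show z: "z p \<in> edom h"
      using prox_step_growth(1)[OF pcc lam, of "c p"] by (simp add: z_def edom_real_add)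
    show "\<psi> p (z p) + (norm (u - z p))\<^sup>2 / (2 * lam) \<le> \<psi> p u" if "u \<in> edom h" for u
      using prox_step_growth(2)[OF pcc lam, of u "c p"] that z
      by (simp add: z_def edom_real_add real_eq \<psi>_def)
  qed
  obtain T where T: "countable T" "T \<subseteq> (\<lambda>u. (u, H u)) ` edom h"
    "(\<lambda>u. (u, H u)) ` edom h \<subseteq> closure T"
    using separable by blast
  have "T \<noteq> {}"
    using T(3) h by (auto simp: proper_closed_convex_def)
  define q where "q n = fst (from_nat_into T n)" for n
  have q_T: "(q n, H (q n)) \<in> T" and q_dom: "q n \<in> edom h" for n
    using from_nat_into[OF \<open>T \<noteq> {}\<close>, of n] T(2) by (auto simp: q_def)
  have approx: "\<exists>n. \<psi> p (q n) < \<psi> p u + e" if p: "p \<in> space N" and u: "u \<in> edom h" and e: "0 < e"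
    for p u and e :: real
  proof -
    have g_cont: "continuous_on UNIV (g p)"
      using convex_on_continuous[OF open_UNIV convex[OF p]] .
    define G where "G = (\<lambda>y. g p (fst y) + snd y + (norm (fst y - c p))\<^sup>2 / (2 * lam))"
    have "continuous_on UNIV G"
      unfolding G_def using lam
      by (intro continuous_on_add continuous_on_divide continuous_on_power continuous_on_norm
          continuous_on_diff continuous_on_fst continuous_on_snd continuous_on_id
          continuous_on_const continuous_on_compose2[OF g_cont]) auto
    then have "open (G -` {..<\<psi> p u + e})"
      by (intro open_vimage) auto
    moreover have "(u, H u) \<in> G -` {..<\<psi> p u + e}"
      using e by (simp add: G_def \<psi>_def)
    moreover have "(u, H u) \<in> closure T"
      using u T(3) by blast
    ultimately have "G -` {..<\<psi> p u + e} \<inter> T \<noteq> {}"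
      using open_Int_closure_eq_empty[of "G -` {..<\<psi> p u + e}" T] by blast
    then obtain y where y: "y \<in> T" "G y < \<psi> p u + e" by auto
    obtain n where n: "from_nat_into T n = y"
      using from_nat_into_surj[OF T(1) y(1)] by auto
    have "snd y = H (fst y)" using y(1) T(2) by auto
    then have "\<psi> p (q n) = G y"
      using n by (simp add: q_def G_def \<psi>_def)
    with y show ?thesis by (intro exI[of _ n]) linarith
  qed
  define good where "good m p n \<longleftrightarrow> (\<forall>i. \<psi> p (q n) \<le> \<psi> p (q i) + 1 / real (Suc m))" for m p n
  define zz where "zz m p = q (LEAST n. good m p n)" for m p
  have \<psi>_meas: "(\<lambda>p. \<psi> p u) \<in> borel_measurable N" for u
  proof -
    have "(\<lambda>p. u - c p) \<in> borel_measurable N"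
      by (rule borel_measurable_diff[OF borel_measurable_const c])
    then have "(\<lambda>p. norm (u - c p)) \<in> borel_measurable N"
      by (rule borel_measurable_norm[THEN measurable_compose_rev])
    then show ?thesis
      unfolding \<psi>_def
      by (rule borel_measurable_add[OF borel_measurable_add[OF meas borel_measurable_const]
            borel_measurable_divide[OF borel_measurable_power borel_measurable_const]])
  qed
  have zz_meas: "zz m \<in> borel_measurable N" for m
  proof -
    have "(\<lambda>p. LEAST n. good m p n) \<in> measurable N (count_space UNIV)"
    proof (rule measurable_Least)
      fix n
      have "Measurable.pred N (\<lambda>p. \<psi> p (q n) \<le> \<psi> p (q i) + 1 / real (Suc m))" for i
        unfolding pred_def
        by (intro borel_measurable_le borel_measurable_add \<psi>_meas borel_measurable_const)
      then show "Measurable.pred N (\<lambda>p. good m p n)"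
        unfolding good_def by (rule pred_intros_countable(1))
    qed
    then show ?thesis
      unfolding zz_def by (rule measurable_compose) simp
  qed
  show ?thesis
    unfolding z_def[symmetric]
  proof (rule borel_measurable_LIMSEQ_metric[OF zz_meas])
    fix p assume p: "p \<in> space N"
    have "(norm (zz m p - z p))\<^sup>2 \<le> 2 * lam / real (Suc m)" for m
    proof -
      obtain n where "\<psi> p (q n) < \<psi> p (z p) + 1 / real (Suc m)"
        using approx[OF p z_dom[OF p], of "1 / real (Suc m)"] by auto
      moreover have "\<psi> p (z p) \<le> \<psi> p (q i)" for i
        using growth[OF p q_dom[of i]] lam by (smt (verit) divide_nonneg_pos zero_le_power2)
      ultimately have "good m p n"
        unfolding good_def by (smt (verit))
      then have "good m p (LEAST n. good m p n)" by (rule LeastI)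
      then have le: "\<psi> p (zz m p) \<le> \<psi> p (q i) + 1 / real (Suc m)" for i
        by (auto simp: good_def zz_def)
      have "\<psi> p (zz m p) \<le> \<psi> p (z p) + 1 / real (Suc m)"
      proof (rule field_le_epsilon)
        fix e :: real assume "0 < e"
        then obtain i where "\<psi> p (q i) < \<psi> p (z p) + e"
          using approx[OF p z_dom[OF p]] by auto
        with le[of i] show "\<psi> p (zz m p) \<le> \<psi> p (z p) + 1 / real (Suc m) + e" by linarith
      qed
      moreover have "\<psi> p (z p) + (norm (zz m p - z p))\<^sup>2 / (2 * lam) \<le> \<psi> p (zz m p)"
        by (rule growth[OF p]) (auto simp: zz_def q_dom)
      ultimately have "(norm (zz m p - z p))\<^sup>2 / (2 * lam) \<le> 1 / real (Suc m)" by linarith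
      then show ?thesis using lam by (simp add: field_simps)
    qed
    moreover have "(\<lambda>m. 2 * lam / real (Suc m)) \<longlonglongrightarrow> 0"
      by (rule LIMSEQ_Suc[OF lim_const_over_n])
    ultimately have "(\<lambda>m. (norm (zz m p - z p))\<^sup>2) \<longlonglongrightarrow> 0"
      by (intro Lim_null_comparison[of "\<lambda>m. (norm (zz m p - z p))\<^sup>2" _ sequentially]) (auto intro: always_eventually)
    from tendsto_real_sqrt[OF this] have "(\<lambda>m. norm (zz m p - z p)) \<longlonglongrightarrow> 0" by simp
    then show "(\<lambda>m. zz m p) \<longlonglongrightarrow> z p"
      by (simp only: tendsto_norm_zero_iff LIM_zero_iff)
  qed
qed



section \<open>The extended expectation\<close>

lemma expect_mono:
  assumes "\<And>\<omega>. \<omega> \<in> space N \<Longrightarrow> X \<omega> \<le> Y \<omega>"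
  shows "expect N X \<le> expect N Y"
proof -
  have "(\<integral>\<^sup>+\<omega>. e2ennreal (X \<omega>) \<partial>N) \<le> (\<integral>\<^sup>+\<omega>. e2ennreal (Y \<omega>) \<partial>N)"
    "(\<integral>\<^sup>+\<omega>. e2ennreal (- Y \<omega>) \<partial>N) \<le> (\<integral>\<^sup>+\<omega>. e2ennreal (- X \<omega>) \<partial>N)"
    using assms by (auto intro!: nn_integral_mono e2ennreal_mono)
  then show ?thesis
    unfolding expect_def by (intro ereal_minus_mono) (auto simp: less_eq_ennreal.rep_eq)
qed

lemma expect_integrable:
  fixes X :: "'w \<Rightarrow> real"
  assumes X: "integrable N X"
  shows "expect N (\<lambda>\<omega>. ereal (X \<omega>)) = ereal (integral\<^sup>L N X)"
proof -
  have "(\<integral>\<^sup>+\<omega>. ennreal (X \<omega>) \<partial>N) < top" "(\<integral>\<^sup>+\<omega>. ennreal (- X \<omega>) \<partial>N) < top"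
    using X unfolding real_integrable_def by (auto simp: less_top)
  then obtain a b where "0 \<le> a" "0 \<le> b"
    "(\<integral>\<^sup>+\<omega>. ennreal (X \<omega>) \<partial>N) = ennreal a" "(\<integral>\<^sup>+\<omega>. ennreal (- X \<omega>) \<partial>N) = ennreal b"
    using less_top_ennreal by metis
  then show ?thesis
    using real_lebesgue_integral_def[OF X] by (simp add: expect_def)
qed

lemma integrable_expect_finite:
  fixes X :: "'w \<Rightarrow> real"
  assumes X: "X \<in> borel_measurable N" and fin: "\<bar>expect N (\<lambda>\<omega>. ereal (X \<omega>))\<bar> \<noteq> \<infinity>"
  shows "integrable N X"
proof -
  let ?a = "\<integral>\<^sup>+\<omega>. ennreal (X \<omega>) \<partial>N" and ?b = "\<integral>\<^sup>+\<omega>. ennreal (- X \<omega>) \<partial>N"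
  have eq: "expect N (\<lambda>\<omega>. ereal (X \<omega>)) = enn2ereal ?a - enn2ereal ?b"
    by (simp add: expect_def)
  have "?a \<noteq> top"
    using fin eq by auto
  moreover from this have "?b \<noteq> top"
    using fin eq by (cases "enn2ereal ?a") auto
  ultimately show ?thesis
    using X by (simp add: real_integrable_def)
qed

lemma expect_nonneg:
  assumes "\<And>\<omega>. \<omega> \<in> space N \<Longrightarrow> 0 \<le> X \<omega>"
  shows "expect N (\<lambda>\<omega>. ereal (X \<omega>)) = enn2ereal (\<integral>\<^sup>+\<omega>. ennreal (X \<omega>) \<partial>N)"
proof -
  have "(\<integral>\<^sup>+\<omega>. ennreal (- X \<omega>) \<partial>N) = (\<integral>\<^sup>+\<omega>. 0 \<partial>N)"
    using assms by (intro nn_integral_cong) (auto simp: ennreal_neg)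
  then show ?thesis by (simp add: expect_def zero_ennreal.rep_eq)
qed


section \<open>Running averages and their parameter\<close>

text \<open>
  The averaging rule of the sequences \<open>z\<^sup>a\<^sub>j\<close> and \<open>u\<^sub>j\<close>, with indices that start at 0 instead of 1.
\<close>

primrec running_avg :: "real \<Rightarrow> (nat \<Rightarrow> real) \<Rightarrow> nat \<Rightarrow> real" where
  "running_avg b a 0 = a 0"
| "running_avg b a (Suc i) = (1 - b) * a (Suc i) + b * running_avg b a i"

lemma running_avg_add:
  "running_avg b (\<lambda>i. x i + y i) n = running_avg b x n + running_avg b y n"
  by (induction n) (auto simp: algebra_simps)

lemma running_avg_mono:
  assumes "0 \<le> b" "b \<le> 1" "\<And>i. i \<le> n \<Longrightarrow> x i \<le> y i"
  shows "running_avg b x n \<le> running_avg b y n"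
  using assms(3) by (induction n) (auto intro!: add_mono mult_left_mono simp: assms(1,2))

lemma running_avg_const: "running_avg b (\<lambda>_. c) n = c"
  by (induction n) (auto simp: algebra_simps)

lemma running_avg_first:
  "running_avg b (\<lambda>i. if i = 0 then x else y) n = b ^ n * x + (1 - b ^ n) * y"
proof (induction n)
  case (Suc n)
  show ?case by (simp only: running_avg.simps Suc.IH) (simp add: algebra_simps)
qed simp

lemma integrable_running_avg:
  fixes X :: "nat \<Rightarrow> 'w \<Rightarrow> real"
  assumes "\<And>i. i \<le> n \<Longrightarrow> integrable N (X i)"
  shows "integrable N (\<lambda>\<omega>. running_avg b (\<lambda>i. X i \<omega>) n)"
    and "(\<integral>\<omega>. running_avg b (\<lambda>i. X i \<omega>) n \<partial>N) = running_avg b (\<lambda>i. \<integral>\<omega>. X i \<omega> \<partial>N) n"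
proof -
  have "integrable N (\<lambda>\<omega>. running_avg b (\<lambda>i. X i \<omega>) n) \<and>
      (\<integral>\<omega>. running_avg b (\<lambda>i. X i \<omega>) n \<partial>N) = running_avg b (\<lambda>i. \<integral>\<omega>. X i \<omega> \<partial>N) n"
    using assms by (induction n) auto
  then show "integrable N (\<lambda>\<omega>. running_avg b (\<lambda>i. X i \<omega>) n)"
    "(\<integral>\<omega>. running_avg b (\<lambda>i. X i \<omega>) n \<partial>N) = running_avg b (\<lambda>i. \<integral>\<omega>. X i \<omega> \<partial>N) n" by auto
qed

lemma ln_over_self_bounds:
  fixes n :: nat
  assumes "2 \<le> n"
  shows "1 \<le> ln (real n + 1)" "ln (real n + 1) \<le> (real n + 1) / 2"
proof -
  have "exp 1 \<le> (3::real)" by (rule exp_le)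
  also have "\<dots> \<le> real n + 1" using assms by simp
  finally show "1 \<le> ln (real n + 1)" using assms by (simp add: ln_ge_iff)
  have "ln ((real n + 1) / 2) \<le> (real n + 1) / 2 - 1"
    using assms by (intro ln_le_minus_one) auto
  moreover have "ln ((real n + 1) / 2) = ln (real n + 1) - ln 2"
    using assms by (intro ln_divide_pos) auto
  moreover have "ln 2 \<le> (1::real)"
    using ln_le_minus_one[of "2::real"] by simp
  ultimately show "ln (real n + 1) \<le> (real n + 1) / 2" by linarith
qed

text \<open>Everything about \<open>\<beta>\<close> follows from a rewriting: with \<open>t = ln (I + 1) / (I + 1)\<close>, the parameter is \<open>\<beta> = (1 - t) / (1 + t)\<close>.\<close>

lemma beta_bounds:
  assumes I: "2 \<le> I"
  defines "t \<equiv> ln (real I + 1) / (real I + 1)"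
  shows "0 < beta I" "beta I < 1" "beta I \<le> exp (- t)" "(1 - beta I) / beta I \<le> 4 * t"
    "0 < t" "t \<le> 1 / 2"
proof -
  note L = ln_over_self_bounds[OF I]
  show t: "0 < t" "t \<le> 1 / 2"
    using L by (auto simp: t_def field_simps)
  have "real I + 1 > 0" by simp
  then have "ln (real I + 1) = t * (real I + 1)" by (simp add: t_def)
  then have "beta I = ((real I + 1) * (1 - t)) / ((real I + 1) * (1 + t))"
    unfolding beta_def by (simp add: algebra_simps)
  then have b: "beta I = (1 - t) / (1 + t)" by simp
  show "0 < beta I" "beta I < 1" using t by (auto simp: b field_simps)
  have "beta I \<le> 1 - t" using t by (simp add: b field_simps)
  also have "\<dots> \<le> exp (- t)" using exp_ge_add_one_self[of "- t"] by simp
  finally show "beta I \<le> exp (- t)" .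
  have "1 - beta I = 2 * t / (1 + t)"
    using t by (simp add: b field_simps)
  then have "(1 - beta I) / beta I = 2 * t / (1 - t)"
    using t by (simp add: b)
  also have "\<dots> \<le> 4 * t" using t mult_left_mono[of t "1/2" t] by (simp add: field_simps)
  finally show "(1 - beta I) / beta I \<le> 4 * t" .
qed

text \<open>
  The first power is the weight of the first step in the final average. The second is the
  contraction of the noise over the half of the steps in which the maximum is never used.
\<close>

lemma beta_powers:
  assumes I: "2 \<le> I"
  defines "t \<equiv> ln (real I + 1) / (real I + 1)"
  shows "beta I ^ (I - 1) \<le> 3 * t" "beta I ^ (I - I div 2) \<le> 2 * sqrt t"
proof -
  note b = beta_bounds[OF I, folded t_def] and L = ln_over_self_bounds[OF I]
  have t_eq: "t * (real I + 1) = ln (real I + 1)" by (simp add: t_def)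
  have inv_le: "1 / (real I + 1) \<le> t"
    using L(1) by (simp add: t_def divide_right_mono)
  have pow: "beta I ^ n \<le> exp (- (real n * t))" for n
  proof -
    have "beta I ^ n \<le> exp (- t) ^ n"
      using b by (intro power_mono) auto
    then show ?thesis by (simp add: exp_of_nat_mult[symmetric])
  qed
  have "- (real (I - 1) * t) = 2 * t + - ln (real I + 1)"
    using I t_eq by (simp add: of_nat_diff algebra_simps)
  then have "beta I ^ (I - 1) \<le> exp (2 * t) * exp (- ln (real I + 1))"
    using pow[of "I - 1"] by (simp only: exp_add)
  also have "exp (- ln (real I + 1)) = 1 / (real I + 1)"
    by (simp add: exp_minus inverse_eq_divide)
  also have "exp (2 * t) * (1 / (real I + 1)) \<le> exp 1 * (1 / (real I + 1))"
    using b by (intro mult_right_mono) auto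
  also have "\<dots> \<le> 3 * t"
    using exp_le inv_le by (intro mult_mono) auto
  finally show "beta I ^ (I - 1) \<le> 3 * t" .
  have half: "real I / 2 \<le> real (I - I div 2)" by (simp add: of_nat_diff)
  have "- (real (I - I div 2) * t) \<le> - (real I / 2 * t)"
    using mult_right_mono[OF half, of t] b by simp
  also have "\<dots> = t / 2 + - ln (real I + 1) / 2"
    using t_eq by (simp add: field_simps)
  finally have "beta I ^ (I - I div 2) \<le> exp (t / 2 + - ln (real I + 1) / 2)"
    using pow[of "I - I div 2"] by (meson exp_le_cancel_iff order_trans)
  also have "\<dots> = exp (t / 2) * exp (- ln (real I + 1) / 2)"
    by (simp only: exp_add)
  also have "exp (- ln (real I + 1) / 2) = sqrt (1 / (real I + 1))"
  proof -
    have "(exp (- ln (real I + 1) / 2))\<^sup>2 = exp (- ln (real I + 1))"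
      by (simp flip: exp_double)
    also have "\<dots> = 1 / (real I + 1)" by (simp add: exp_minus field_simps)
    finally show ?thesis by (metis exp_ge_zero real_sqrt_unique)
  qed
  also have "exp (t / 2) * sqrt (1 / (real I + 1)) \<le> 2 * sqrt t"
  proof (intro mult_mono)
    have "exp (t / 2) \<le> exp (1 / 2 :: real)" using b by simp
    also have "\<dots> \<le> 1 + 1/2 + (1/2)\<^sup>2" by (rule exp_bound) auto
    finally show "exp (t / 2) \<le> 2" by (simp add: power2_eq_square)
  qed (use inv_le in auto)
  finally show "beta I ^ (I - I div 2) \<le> 2 * sqrt t" .
qed



section \<open>The method along one sample path\<close>

text \<open>
  Each noise term is the error of one sample at the comparison point; the recursion repeats that
  of the models, so it majorizes the error of the model there.
\<close>

primrec noise_majorant :: "nat set \<Rightarrow> real \<Rightarrow> (nat \<Rightarrow> real) \<Rightarrow> nat \<Rightarrow> real" where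
  "noise_majorant B b \<Delta> 0 = \<Delta> 0"
| "noise_majorant B b \<Delta> (Suc i) = (1 - b) * \<Delta> (Suc i) +
     b * (if Suc (Suc i) \<in> B then max (noise_majorant B b \<Delta> i) (\<Delta> (Suc i))
          else noise_majorant B b \<Delta> i)"

lemma convex_ereal_combination:
  fixes v :: ereal
  assumes "v \<noteq> -\<infinity>" "0 < b" "b < 1"
  shows "ereal (1 - b) * (ereal x + v) + ereal b * (ereal y + v) = ereal ((1 - b) * x + b * y) + v"
  using assms by (cases v) (auto simp: algebra_simps)

locale stochastic_composite = prob_space Q for Q :: "'b measure" +
  fixes f h :: "'a::euclidean_space \<Rightarrow> ereal"
    and F :: "'a \<Rightarrow> 'b \<Rightarrow> real"
    and s :: "'a \<Rightarrow> 'b \<Rightarrow> 'a"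
    and M lam :: real and I :: nat and B :: "nat set"
  assumes f: "proper_closed_convex f"
    and h: "proper_closed_convex h"
    and dom: "edom h \<subseteq> edom f"
    and F_measurable:
      "(\<lambda>(x, \<xi>). F x \<xi>) \<in> borel_measurable (restrict_space borel (edom h) \<Otimes>\<^sub>M Q)"
    and s_measurable:
      "(\<lambda>(x, \<xi>). s x \<xi>) \<in> borel_measurable (restrict_space borel (edom h) \<Otimes>\<^sub>M Q)"
    and f_eq: "\<forall>x\<in>edom h. f x = expect Q (\<lambda>\<xi>. ereal (F x \<xi>))"
    and s_subgradient:
      "AE \<xi> in Q. \<forall>x\<in>edom h. \<forall>u\<in>edom h. F u \<xi> \<ge> F x \<xi> + s x \<xi> \<bullet> (u - x)"
    and M: "ereal M = noise_bound Q h s"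
    and M_pos: "M > 0"
    and lam: "lam > 0"
    and I: "I \<ge> 2"
begin

definition fval :: "'a \<Rightarrow> real" where "fval x = real_of_ereal (f x)"
definition hval :: "'a \<Rightarrow> real" where "hval x = real_of_ereal (h x)"
definition phival :: "'a \<Rightarrow> real" where "phival x = fval x + hval x"

abbreviation "b \<equiv> beta I"
abbreviation "dom_space \<equiv> restrict_space borel (edom h)"
abbreviation "iterate \<equiv> smax_z h F s lam I B"

lemma b: "0 < b" "b < 1"
  using beta_bounds[OF I] by auto

lemma fval: "x \<in> edom h \<Longrightarrow> f x = ereal (fval x)"
  using ereal_real_pcc[OF f, of x] dom by (auto simp: fval_def)

lemma hval: "x \<in> edom h \<Longrightarrow> h x = ereal (hval x)"
  using ereal_real_pcc[OF h, of x] by (auto simp: hval_def)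

lemma phival: "x \<in> edom h \<Longrightarrow> phi f h x = ereal (phival x)"
  by (simp add: phi_def fval hval phival_def)

lemma F_section: "x \<in> edom h \<Longrightarrow> F x \<in> borel_measurable Q"
  using measurable_Pair2[OF F_measurable, of x] by (simp add: space_restrict_space)

lemma s_section: "x \<in> edom h \<Longrightarrow> s x \<in> borel_measurable Q"
  using measurable_Pair2[OF s_measurable, of x] by (simp add: space_restrict_space)

lemma F_integrable:
  assumes "x \<in> edom h"
  shows "integrable Q (F x)" "integral\<^sup>L Q (F x) = fval x"
proof -
  have eq: "ereal (fval x) = expect Q (\<lambda>\<xi>. ereal (F x \<xi>))"
    using f_eq fval assms by auto
  then show int: "integrable Q (F x)"
    by (intro integrable_expect_finite F_section assms) (simp flip: eq)
  show "integral\<^sup>L Q (F x) = fval x"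
    using eq expect_integrable[OF int] by simp
qed

lemma s_second_moment:
  assumes x: "x \<in> edom h"
  shows "(\<integral>\<^sup>+\<xi>. ennreal ((norm (s x \<xi>))\<^sup>2) \<partial>Q) \<le> ennreal (M\<^sup>2)"
proof -
  let ?e = "\<integral>\<^sup>+\<xi>. ennreal ((norm (s x \<xi>))\<^sup>2) \<partial>Q"
  have "ereal_sqrt (enn2ereal ?e) \<le> ereal M"
    unfolding M noise_bound_def using x
    by (intro SUP_upper2[OF x]) (simp add: expect_nonneg)
  then show ?thesis
  proof (cases ?e)
    case (real r)
    then have "sqrt r \<le> M"
      using \<open>ereal_sqrt (enn2ereal ?e) \<le> ereal M\<close> by (simp add: ereal_sqrt_def)
    then have "r \<le> M\<^sup>2"
      using real by (metis real_sqrt_le_iff real_sqrt_abs abs_of_pos M_pos)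
    then show ?thesis using real by (simp add: ennreal_leI)
  qed (auto simp: ereal_sqrt_def)
qed

lemma s_square_integrable:
  assumes x: "x \<in> edom h"
  shows "integrable Q (\<lambda>\<xi>. (norm (s x \<xi>))\<^sup>2)" "(\<integral>\<xi>. (norm (s x \<xi>))\<^sup>2 \<partial>Q) \<le> M\<^sup>2"
proof -
  note [measurable] = s_section[OF x]
  show int: "integrable Q (\<lambda>\<xi>. (norm (s x \<xi>))\<^sup>2)"
    using s_second_moment[OF x]
    by (intro integrableI_nonneg) (auto simp: top_unique intro: le_less_trans)
  show "(\<integral>\<xi>. (norm (s x \<xi>))\<^sup>2 \<partial>Q) \<le> M\<^sup>2"
    using s_second_moment[OF x] nn_integral_eq_integral[OF int] by simp
qed

lemma s_norm_integrable:
  assumes x: "x \<in> edom h"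
  shows "integrable Q (\<lambda>\<xi>. norm (s x \<xi>))" "(\<integral>\<xi>. norm (s x \<xi>) \<partial>Q) \<le> M"
proof -
  note [measurable] = s_section[OF x]
  \<comment> \<open>\<open>a \<le> (a\<^sup>2 / M + M) / 2\<close> is the inequality of means, and is tight at \<open>a = M\<close>\<close>
  have le: "norm (s x \<xi>) \<le> ((norm (s x \<xi>))\<^sup>2 / M + M) / 2" for \<xi>
  proof -
    have "0 \<le> (norm (s x \<xi>) - M)\<^sup>2" by simp
    then show ?thesis using M_pos by (simp add: field_simps power2_eq_square)
  qed
  have int: "integrable Q (\<lambda>\<xi>. ((norm (s x \<xi>))\<^sup>2 / M + M) / 2)"
    using s_square_integrable[OF x] by auto
  then show int1: "integrable Q (\<lambda>\<xi>. norm (s x \<xi>))"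
  proof (rule Bochner_Integration.integrable_bound)
    show "AE \<xi> in Q. norm (norm (s x \<xi>)) \<le> norm (((norm (s x \<xi>))\<^sup>2 / M + M) / 2)"
      using order_trans[OF le abs_ge_self] by (intro AE_I2) simp
  qed measurable
  have "(\<integral>\<xi>. norm (s x \<xi>) \<partial>Q) \<le> (\<integral>\<xi>. ((norm (s x \<xi>))\<^sup>2 / M + M) / 2 \<partial>Q)"
    by (intro integral_mono int1 int le)
  also have "\<dots> = ((\<integral>\<xi>. (norm (s x \<xi>))\<^sup>2 \<partial>Q) / M + M) / 2"
    using s_square_integrable[OF x] by (simp add: prob_space)
  also have "\<dots> \<le> (M\<^sup>2 / M + M) / 2"
    using s_square_integrable[OF x] M_pos by (intro divide_right_mono add_mono) auto
  also have "\<dots> = M" using M_pos by (simp add: power2_eq_square)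
  finally show "(\<integral>\<xi>. norm (s x \<xi>) \<partial>Q) \<le> M" .
qed

text \<open>
  Averaging the sampled subgradient inequality, because the mean norm of a subgradient is at
  most \<open>M\<close>.
\<close>

lemma fval_lipschitz:
  assumes x: "x \<in> edom h" and u: "u \<in> edom h"
  shows "fval x - fval u \<le> M * norm (u - x)"
proof -
  have "AE \<xi> in Q. F x \<xi> - F u \<xi> \<le> norm (s x \<xi>) * norm (u - x)"
    using s_subgradient
  proof eventually_elim
    case (elim \<xi>)
    then have "F x \<xi> - F u \<xi> \<le> - (s x \<xi> \<bullet> (u - x))" using x u by force
    also have "\<dots> \<le> norm (s x \<xi>) * norm (u - x)"
      using Cauchy_Schwarz_ineq2[of "s x \<xi>" "u - x"] by linarith
    finally show ?case .
  qed
  then have "(\<integral>\<xi>. F x \<xi> - F u \<xi> \<partial>Q) \<le> (\<integral>\<xi>. norm (s x \<xi>) * norm (u - x) \<partial>Q)"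
    using F_integrable x u s_norm_integrable by (intro integral_mono_AE) auto
  also have "\<dots> \<le> M * norm (u - x)"
    using s_norm_integrable[OF x] by (auto intro: mult_right_mono)
  finally show ?thesis
    using F_integrable x u by simp
qed

definition cutting_plane :: "'a \<Rightarrow> 'b \<Rightarrow> 'a \<Rightarrow> real" where
  "cutting_plane x \<xi> u = F x \<xi> + s x \<xi> \<bullet> (u - x)"

text \<open>
  The models without their common summand \<open>h\<close>. They are finite and convex, hence continuous, so that
  all extended values of the method sit in the fixed function \<open>h\<close>.
\<close>

fun cut_model :: "'a \<Rightarrow> (nat \<Rightarrow> 'b) \<Rightarrow> nat \<Rightarrow> 'a \<Rightarrow> real" where
  "cut_model z0 w 0 u = 0"
| "cut_model z0 w (Suc 0) u = cutting_plane z0 (w 0) u"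
| "cut_model z0 w (Suc (Suc i)) u =
     (1 - b) * cutting_plane (iterate z0 w (Suc i)) (w (Suc i)) u +
     b * (if Suc (Suc i) \<in> B
          then max (cut_model z0 w (Suc i) u) (cutting_plane (iterate z0 w (Suc i)) (w (Suc i)) u)
          else cut_model z0 w (Suc i) u)"

lemma lin_cutting_plane: "lin h F s x \<xi> u = ereal (cutting_plane x \<xi> u) + h u"
  unfolding lin_def cutting_plane_def by (cases "h u") auto

lemma max_ereal_add: "v \<noteq> -\<infinity> \<Longrightarrow> max (ereal x + v) (ereal y + v) = ereal (max x y) + v"
  by (cases v) (auto simp: max_def)

lemma smax_model_eq:
  "smax_model h F s lam I B z0 w j = (\<lambda>u. ereal (cut_model z0 w j u) + h u)"
proof -
  have "\<forall>u. smax_model h F s lam I B z0 w j u = ereal (cut_model z0 w j u) + h u"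
  proof (induction j rule: induct_nat_012)
    case (ge2 i)
    have hu: "h u \<noteq> -\<infinity>" for u using h by (simp add: proper_closed_convex_def)
    have z: "prox_step lam z0 (smax_model h F s lam I B z0 w (Suc i)) = iterate z0 w (Suc i)"
      by (simp add: smax_z_def)
    show ?case
      unfolding smax_model.simps Let_def diff_Suc_1 z
      using ge2 hu b by (auto simp: lin_cutting_plane max_ereal_add convex_ereal_combination
          simp flip: ereal_max)
  qed (auto simp: lin_cutting_plane)
  then show ?thesis by auto
qed

lemma convex_on_cut: "convex_on UNIV (cutting_plane x \<xi>)"
  by (rule convex_onI) (auto simp: cutting_plane_def algebra_simps inner_add_right inner_diff_right)

lemma convex_on_combination:
  assumes "convex_on UNIV g" "convex_on UNIV k"
  shows "convex_on UNIV (\<lambda>u. (1 - b) * g u + b * k u)"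
  using assms b by (intro convex_on_add convex_on_cmul) auto

lemma convex_on_cut_model: "convex_on UNIV (cut_model z0 w j)"
proof (induction j rule: induct_nat_012)
  case 0
  show ?case by (rule convex_onI) auto
next
  case 1
  have "cut_model z0 w (Suc 0) = cutting_plane z0 (w 0)" by auto
  then show ?case using convex_on_cut by simp
next
  case (ge2 i)
  have "cut_model z0 w (Suc (Suc i)) =
     (\<lambda>u. (1 - b) * cutting_plane (iterate z0 w (Suc i)) (w (Suc i)) u +
      b * (if Suc (Suc i) \<in> B
          then (\<lambda>u. max (cut_model z0 w (Suc i) u) (cutting_plane (iterate z0 w (Suc i)) (w (Suc i)) u))
          else cut_model z0 w (Suc i)) u)" by auto
  then show ?case
    using ge2 convex_on_cut by (auto intro!: convex_on_combination convex_on_max)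
qed

lemma iterate_Suc:
  "iterate z0 w (Suc i) = prox_step lam z0 (\<lambda>u. ereal (cut_model z0 w (Suc i) u) + h u)"
  by (simp add: smax_z_def smax_model_eq)

lemma iterate_0: "iterate z0 w 0 = z0"
  by (simp add: smax_z_def)

lemma iterate_in_edom:
  assumes "z0 \<in> edom h"
  shows "iterate z0 w j \<in> edom h"
proof (cases j)
  case (Suc i)
  show ?thesis
    using prox_step_growth(1)[OF pcc_real_add[OF h convex_on_cut_model] lam, of z0 z0 w "Suc i"]
    unfolding Suc iterate_Suc edom_real_add .
qed (use assms in \<open>simp add: iterate_0\<close>)

text \<open>The optimal value of the \<open>(i + 1)\<close>-st proximal subproblem.\<close>

definition model_min :: "'a \<Rightarrow> (nat \<Rightarrow> 'b) \<Rightarrow> nat \<Rightarrow> real" where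
  "model_min z0 w i = cut_model z0 w (Suc i) (iterate z0 w (Suc i)) + hval (iterate z0 w (Suc i)) +
     (norm (iterate z0 w (Suc i) - z0))\<^sup>2 / (2 * lam)"

lemma model_min_growth:
  assumes u: "u \<in> edom h"
  shows "model_min z0 w i + (norm (u - iterate z0 w (Suc i)))\<^sup>2 / (2 * lam)
    \<le> cut_model z0 w (Suc i) u + hval u + (norm (u - z0))\<^sup>2 / (2 * lam)"
proof -
  have pcc: "proper_closed_convex (\<lambda>u. ereal (cut_model z0 w (Suc i) u) + h u)"
    by (rule pcc_real_add[OF h convex_on_cut_model])
  have eq: "real_of_ereal (ereal r + h v) = r + hval v" if "v \<in> edom h" for r v
    using hval[OF that] by simp
  have z: "iterate z0 w (Suc i) \<in> edom h"
    using prox_step_growth(1)[OF pcc lam, of z0] unfolding iterate_Suc edom_real_add .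
  show ?thesis
    using prox_step_growth(2)[OF pcc lam, of u z0] u z
    by (simp only: edom_real_add eq model_min_def flip: iterate_Suc)
qed

definition sample_error :: "'a \<Rightarrow> (nat \<Rightarrow> 'b) \<Rightarrow> nat \<Rightarrow> real" where
  "sample_error z0 w i = F (iterate z0 w i) (w i) - fval (iterate z0 w i)"

text \<open>
  The factor of the square is reciprocal to the share of the quadratic growth that a step can use:
  the first cut enters its model with weight 1 and meets the whole proximal term, a later cut
  enters with weight \<open>1 - \<beta>\<close> against growth weighted by \<open>\<beta>\<close>.
\<close>

definition step_penalty :: "'a \<Rightarrow> (nat \<Rightarrow> 'b) \<Rightarrow> nat \<Rightarrow> real" where
  "step_penalty z0 w i = - sample_error z0 w i +
     lam / 2 * (if i = 0 then 1 else (1 - b) / b) * (M + norm (s (iterate z0 w i) (w i)))\<^sup>2"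

text \<open>
  A cut at \<open>x\<close> may lie below \<open>f\<close> at \<open>y\<close> by at most \<open>(M + \<bar>s\<bar>) \<bar>y - x\<bar>\<close>, by the Lipschitz bound,
  apart from the sampling error at \<open>x\<close>. A product of the form \<open>a d\<close> splits into multiples of \<open>a\<^sup>2\<close> and
  \<open>d\<^sup>2\<close>, with \<open>k\<close> free to match the growth of the proximal subproblem.
\<close>

lemma cut_gap:
  assumes x: "x \<in> edom h" and y: "y \<in> edom h" and k: "0 < k"
  shows "fval y - cutting_plane x \<xi> y \<le> - (F x \<xi> - fval x) + lam / 2 * k * (M + norm (s x \<xi>))\<^sup>2
    + (norm (y - x))\<^sup>2 / (2 * lam * k)"
proof -
  define a d where "a = M + norm (s x \<xi>)" and "d = norm (y - x)"
  have "fval y - cutting_plane x \<xi> y \<le> - (F x \<xi> - fval x) + a * d"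
    using fval_lipschitz[OF y x] Cauchy_Schwarz_ineq2[of "s x \<xi>" "y - x"]
    by (auto simp: cutting_plane_def a_def d_def norm_minus_commute algebra_simps)
  moreover have "a * d \<le> lam / 2 * k * a\<^sup>2 + d\<^sup>2 / (2 * lam * k)"
  proof -
    have "0 \<le> (lam * k * a - d)\<^sup>2 / (2 * lam * k)" using lam k by simp
    also have "\<dots> = lam / 2 * k * a\<^sup>2 + d\<^sup>2 / (2 * lam * k) - a * d"
      using lam k by (simp add: field_simps power2_eq_square)
    finally show ?thesis by simp
  qed
  ultimately show ?thesis by (simp add: a_def d_def)
qed

text \<open>
  Both sides satisfy nearly the same recursion. Evaluated at the new iterate, the new model is at
  least the convex combination of the new cut and the old model; the old proximal subproblem has
  grown there by the squared distance of the two iterates, and the new cut falls short of the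
  objective by a term that this growth absorbs.
\<close>

lemma values_le_model_min:
  assumes z0: "z0 \<in> edom h"
  shows "running_avg b (\<lambda>k. phival (iterate z0 w (Suc k))) i
    \<le> model_min z0 w i + running_avg b (step_penalty z0 w) i"
proof (induction i)
  case 0
  have "fval (iterate z0 w 1) - cutting_plane z0 (w 0) (iterate z0 w 1) \<le>
      step_penalty z0 w 0 + (norm (iterate z0 w 1 - z0))\<^sup>2 / (2 * lam)"
    using cut_gap[OF z0 iterate_in_edom[OF z0], where k = 1]
    by (simp add: step_penalty_def sample_error_def iterate_0)
  then show ?case
    by (simp add: model_min_def phival_def)
next
  case (Suc i)
  define x y where "x = iterate z0 w (Suc i)" and "y = iterate z0 w (Suc (Suc i))"
  have x: "x \<in> edom h" and y: "y \<in> edom h"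
    by (auto simp: x_def y_def iterate_in_edom z0)
  define q where "q u v = (norm (u - v))\<^sup>2 / (2 * lam)" for u v :: 'a
  have q: "0 \<le> q u v" for u v using lam by (simp add: q_def)
  define c where "c = cutting_plane x (w (Suc i)) y"
  define p where "p = step_penalty z0 w (Suc i)"
  define m where "m = cut_model z0 w (Suc i) y"
  have gap: "fval y - c \<le> p + b / (1 - b) * q y x"
    using cut_gap[OF x y, where k = "(1 - b) / b" and \<xi> = "w (Suc i)"] b
    by (simp add: c_def p_def q_def step_penalty_def sample_error_def x_def field_simps)
  have growth: "model_min z0 w i + q y x \<le> m + hval y + q y z0"
    using model_min_growth[OF y, of z0 w i] by (simp add: q_def x_def m_def)
  have "(1 - b) * c + b * m \<le> cut_model z0 w (Suc (Suc i)) y"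
    using b by (auto simp: c_def m_def x_def intro!: mult_left_mono)
  then have "(1 - b) * c + b * m + hval y + q y z0 \<le> model_min z0 w (Suc i)"
    by (simp add: model_min_def y_def q_def)
  moreover have "b * (model_min z0 w i + q y x) \<le> b * (m + hval y + q y z0)"
    using growth b by (intro mult_left_mono) auto
  moreover have "(1 - b) * (fval y - c) \<le> (1 - b) * (p + b / (1 - b) * q y x)"
    using gap b by (intro mult_left_mono) auto
  moreover have "(1 - b) * (p + b / (1 - b) * q y x) = (1 - b) * p + b * q y x"
    using b by (simp add: field_simps)
  moreover have "0 \<le> (1 - b) * q y z0" using b q by simp
  ultimately have "(1 - b) * phival y + b * model_min z0 w i \<le> model_min z0 w (Suc i) + (1 - b) * p"
    by (simp add: phival_def algebra_simps)
  moreover have "b * running_avg b (\<lambda>k. phival (iterate z0 w (Suc k))) i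
      \<le> b * (model_min z0 w i + running_avg b (step_penalty z0 w) i)"
    using Suc b by (intro mult_left_mono) auto
  ultimately show ?case
    by (simp add: p_def y_def algebra_simps)
qed

definition subgradient_sample :: "'b \<Rightarrow> bool" where
  "subgradient_sample \<xi> \<longleftrightarrow> (\<forall>x\<in>edom h. \<forall>u\<in>edom h. F u \<xi> \<ge> F x \<xi> + s x \<xi> \<bullet> (u - x))"

text \<open>
  Every cut lies below its sampled function at \<open>u\<close>, and the models combine cuts monotonically, so
  the same combination of the sampled values is an upper bound.
\<close>

lemma cut_model_le_noise:
  assumes z0: "z0 \<in> edom h" and u: "u \<in> edom h"
    and w: "\<And>k. k \<le> i \<Longrightarrow> subgradient_sample (w k)"
  shows "cut_model z0 w (Suc i) u \<le> fval u + noise_majorant B b (\<lambda>k. F u (w k) - fval u) i"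
  using w
proof (induction i)
  case 0
  then show ?case using z0 u by (auto simp: cutting_plane_def subgradient_sample_def)
next
  case (Suc i)
  define c where "c = cutting_plane (iterate z0 w (Suc i)) (w (Suc i)) u"
  define m where "m = cut_model z0 w (Suc i) u"
  define n where "n = noise_majorant B b (\<lambda>k. F u (w k) - fval u) i"
  have c: "c \<le> F u (w (Suc i))"
    using Suc.prems[of "Suc i"] u iterate_in_edom[OF z0]
    by (auto simp: c_def cutting_plane_def subgradient_sample_def)
  have m: "m \<le> fval u + n" using Suc by (simp add: m_def n_def)
  have "(1 - b) * c \<le> (1 - b) * F u (w (Suc i))" using c b by (intro mult_left_mono) auto
  moreover have "b * m \<le> b * (fval u + n)" using m b by (intro mult_left_mono) auto
  moreover have "b * max m c \<le> b * (fval u + max n (F u (w (Suc i)) - fval u))"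
    using m c b by (intro mult_left_mono) (auto simp: max_def)
  ultimately show ?case
    by (auto simp: algebra_simps simp flip: c_def m_def n_def)
qed

text \<open>
  The optimal value of the last proximal subproblem links the two sides: it bounds the average of
  the objective values from above, up to penalties, and by quadratic growth it stays below the
  value of the subproblem at \<open>u\<close> by the squared distance of the new centre to \<open>u\<close>.
\<close>

lemma path_inequality:
  assumes z0: "z0 \<in> edom h" and u: "u \<in> edom h"
    and w: "\<And>k. k \<le> i \<Longrightarrow> subgradient_sample (w k)"
  shows "running_avg b (\<lambda>k. phival (iterate z0 w (Suc k))) i
      + (norm (u - iterate z0 w (Suc i)))\<^sup>2 / (2 * lam)
    \<le> phival u + running_avg b (step_penalty z0 w) i
      + noise_majorant B b (\<lambda>k. F u (w k) - fval u) i + (norm (u - z0))\<^sup>2 / (2 * lam)"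
  using values_le_model_min[OF z0, of w i] model_min_growth[OF u, of z0 w i]
    cut_model_le_noise[of z0 u i w] assms by (auto simp: phival_def)

end



section \<open>The expected noise of the models\<close>

lemma integrable_noise_majorant:
  fixes \<Delta> :: "nat \<Rightarrow> 'w \<Rightarrow> real"
  assumes "\<And>k. k \<le> n \<Longrightarrow> integrable P (\<Delta> k)"
  shows "integrable P (\<lambda>\<omega>. noise_majorant B b (\<lambda>k. \<Delta> k \<omega>) n)"
  using assms
proof (induction n)
  case (Suc n)
  then show ?case
    by (cases "Suc (Suc n) \<in> B")
      (auto intro!: Bochner_Integration.integrable_add integrable_mult_right integrable_max)
qed simp

lemma integral_noise_majorant_no_max:
  fixes \<Delta> :: "nat \<Rightarrow> 'w \<Rightarrow> real"
  assumes int: "\<And>k. k \<le> m + n \<Longrightarrow> integrable P (\<Delta> k)"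
    and mean: "\<And>k. k \<le> m + n \<Longrightarrow> (\<integral>\<omega>. \<Delta> k \<omega> \<partial>P) = 0"
    and B: "\<And>k. k \<in> B \<Longrightarrow> k \<le> Suc m"
  shows "(\<integral>\<omega>. noise_majorant B b (\<lambda>k. \<Delta> k \<omega>) (m + n) \<partial>P)
    = b ^ n * (\<integral>\<omega>. noise_majorant B b (\<lambda>k. \<Delta> k \<omega>) m \<partial>P)"
  using int mean
proof (induction n)
  case (Suc n)
  have "Suc (Suc (m + n)) \<notin> B" using B[of "Suc (Suc (m + n))"] by auto
  moreover have "integrable P (\<lambda>\<omega>. noise_majorant B b (\<lambda>k. \<Delta> k \<omega>) (m + n))"
    by (rule integrable_noise_majorant) (use Suc in auto)
  ultimately show ?case using Suc by simp
qed simp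

text \<open>
  Since \<open>max a d \<^sup>2 \<le> a\<^sup>2 + d\<^sup>2\<close>, every use of the maximum adds at most one variance to the second
  moment; the convex combinations do not increase it.
\<close>

lemma second_moment_noise_majorant:
  fixes \<Delta> :: "nat \<Rightarrow> 'w \<Rightarrow> real"
  assumes b: "0 \<le> b" "b \<le> 1" and one: "1 \<in> B" and v: "0 \<le> v"
    and meas: "\<And>k. k \<le> n \<Longrightarrow> \<Delta> k \<in> borel_measurable P"
    and int: "\<And>k. k \<le> n \<Longrightarrow> integrable P (\<lambda>\<omega>. (\<Delta> k \<omega>)\<^sup>2)"
    and var: "\<And>k. k \<le> n \<Longrightarrow> (\<integral>\<omega>. (\<Delta> k \<omega>)\<^sup>2 \<partial>P) \<le> v"
  shows "(\<lambda>\<omega>. noise_majorant B b (\<lambda>k. \<Delta> k \<omega>) n) \<in> borel_measurable P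
    \<and> integrable P (\<lambda>\<omega>. (noise_majorant B b (\<lambda>k. \<Delta> k \<omega>) n)\<^sup>2)
    \<and> (\<integral>\<omega>. (noise_majorant B b (\<lambda>k. \<Delta> k \<omega>) n)\<^sup>2 \<partial>P) \<le> real (card (B \<inter> {1..Suc n})) * v"
  using meas int var
proof (induction n)
  case 0
  have "B \<inter> {1..Suc 0} = {1}" using one by auto
  then show ?case using 0 by simp
next
  case (Suc n)
  define a where "a = (\<lambda>\<omega>. noise_majorant B b (\<lambda>k. \<Delta> k \<omega>) n)"
  define d where "d = \<Delta> (Suc n)"
  define c where "c = card (B \<inter> {1..Suc n})"
  define r where "r = (if Suc (Suc n) \<in> B then 1 else 1 - b)"
  define a' where "a' = (\<lambda>\<omega>. noise_majorant B b (\<lambda>k. \<Delta> k \<omega>) (Suc n))"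
  have IH: "a \<in> borel_measurable P" "integrable P (\<lambda>\<omega>. (a \<omega>)\<^sup>2)" "(\<integral>\<omega>. (a \<omega>)\<^sup>2 \<partial>P) \<le> real c * v"
    using Suc by (auto simp: a_def c_def)
  have d: "d \<in> borel_measurable P" "integrable P (\<lambda>\<omega>. (d \<omega>)\<^sup>2)" "(\<integral>\<omega>. (d \<omega>)\<^sup>2 \<partial>P) \<le> v"
    using Suc by (auto simp: d_def)
  note [measurable] = IH(1) d(1)
  have "a' = (\<lambda>\<omega>. (1 - b) * d \<omega> + b * (if Suc (Suc n) \<in> B then max (a \<omega>) (d \<omega>) else a \<omega>))"
    unfolding a'_def a_def d_def by simp
  then have a'_meas [measurable]: "a' \<in> borel_measurable P"
    by (cases "Suc (Suc n) \<in> B") simp_all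
  have square_combination: "((1 - b) * x + b * y)\<^sup>2 \<le> (1 - b) * x\<^sup>2 + b * y\<^sup>2" for x y :: real
  proof -
    have "(1 - b) * x\<^sup>2 + b * y\<^sup>2 - ((1 - b) * x + b * y)\<^sup>2 = b * (1 - b) * (x - y)\<^sup>2"
      by (simp add: power2_eq_square algebra_simps)
    moreover have "0 \<le> b * (1 - b) * (x - y)\<^sup>2" using b by simp
    ultimately show ?thesis by linarith
  qed
  have le: "(a' \<omega>)\<^sup>2 \<le> r * (d \<omega>)\<^sup>2 + b * (a \<omega>)\<^sup>2" for \<omega>
  proof (cases "Suc (Suc n) \<in> B")
    case True
    have "(a' \<omega>)\<^sup>2 \<le> (1 - b) * (d \<omega>)\<^sup>2 + b * (max (a \<omega>) (d \<omega>))\<^sup>2"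
      using True square_combination by (simp add: a'_def a_def d_def)
    also have "\<dots> \<le> (1 - b) * (d \<omega>)\<^sup>2 + b * ((a \<omega>)\<^sup>2 + (d \<omega>)\<^sup>2)"
      using b by (intro add_left_mono mult_left_mono) (auto simp: max_def)
    finally show ?thesis using True by (simp add: r_def algebra_simps)
  next
    case False
    then show ?thesis using square_combination by (simp add: a'_def a_def d_def r_def)
  qed
  have int_r: "integrable P (\<lambda>\<omega>. r * (d \<omega>)\<^sup>2 + b * (a \<omega>)\<^sup>2)"
    using IH d by auto
  have int_a': "integrable P (\<lambda>\<omega>. (a' \<omega>)\<^sup>2)"
  proof (rule Bochner_Integration.integrable_bound[OF int_r])
    show "AE \<omega> in P. norm ((a' \<omega>)\<^sup>2) \<le> norm (r * (d \<omega>)\<^sup>2 + b * (a \<omega>)\<^sup>2)"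
      using order_trans[OF le abs_ge_self] by (intro AE_I2) simp
  qed measurable
  have r: "0 \<le> r" using b by (simp add: r_def)
  have "(\<integral>\<omega>. (a' \<omega>)\<^sup>2 \<partial>P) \<le> (\<integral>\<omega>. r * (d \<omega>)\<^sup>2 + b * (a \<omega>)\<^sup>2 \<partial>P)"
    by (intro integral_mono int_a' int_r le)
  also have "\<dots> = r * (\<integral>\<omega>. (d \<omega>)\<^sup>2 \<partial>P) + b * (\<integral>\<omega>. (a \<omega>)\<^sup>2 \<partial>P)"
    using IH d by simp
  also have "\<dots> \<le> r * v + b * (real c * v)"
    using IH d b r by (intro add_mono mult_left_mono) auto
  also have "\<dots> \<le> real (card (B \<inter> {1..Suc (Suc n)})) * v"
  proof (cases "Suc (Suc n) \<in> B")
    case True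
    then have "B \<inter> {1..Suc (Suc n)} = insert (Suc (Suc n)) (B \<inter> {1..Suc n})" by auto
    then have "card (B \<inter> {1..Suc (Suc n)}) = Suc c" by (simp add: c_def)
    moreover have "b * (real c * v) \<le> 1 * (real c * v)" using b v by (intro mult_right_mono) auto
    ultimately show ?thesis using True by (simp add: r_def algebra_simps)
  next
    case False
    then have "B \<inter> {1..Suc (Suc n)} = B \<inter> {1..Suc n}" by (auto simp: le_Suc_eq)
    moreover have "1 \<le> c"
    proof -
      have "1 \<in> B \<inter> {1..Suc n}" using one by auto
      then have "B \<inter> {1..Suc n} \<noteq> {}" by blast
      then show ?thesis by (simp add: c_def Suc_le_eq card_gt_0_iff)
    qed
    then have "(1 - b) * v \<le> (1 - b) * (real c * v)"
      using b v mult_right_mono[of 1 "real c" v] by (intro mult_left_mono) auto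
    ultimately show ?thesis using False by (simp add: r_def c_def algebra_simps)
  qed
  finally show ?case using int_a' a'_meas by (simp add: a'_def)
qed

lemma (in prob_space) expectation_le_sqrt_second_moment:
  fixes X :: "'a \<Rightarrow> real"
  assumes X: "X \<in> borel_measurable M" and sq: "integrable M (\<lambda>x. (X x)\<^sup>2)"
  shows "expectation X \<le> sqrt (expectation (\<lambda>x. (X x)\<^sup>2))"
proof -
  have "integrable M X" by (rule square_integrable_imp_integrable[OF X sq])
  then have "variance X = expectation (\<lambda>x. (X x)\<^sup>2) - (expectation X)\<^sup>2"
    using sq by (rule variance_eq)
  moreover have "0 \<le> variance X" by (rule variance_positive)
  ultimately show ?thesis by (intro real_le_rsqrt) simp
qed

text \<open>
  The maximum is not used after step \<open>I div 2\<close>, so the expected noise decays geometrically from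
  there on, in total by a factor of at most \<open>2 * sqrt t\<close> with
  \<open>t = ln (I + 1) / (I + 1)\<close>. If the maximum is never used, that is
  \<open>B = {1}\<close>, the noise is a weighted sum of mean-zero terms.
\<close>

lemma expected_noise_le:
  fixes \<Delta> :: "nat \<Rightarrow> 'w \<Rightarrow> real"
  assumes P: "prob_space P" and I: "2 \<le> I" and B: "{1} \<subseteq> B" "B \<subseteq> {1..I div 2}"
    and meas: "\<And>k. k < I \<Longrightarrow> \<Delta> k \<in> borel_measurable P"
    and mean: "\<And>k. k < I \<Longrightarrow> integrable P (\<Delta> k)" "\<And>k. k < I \<Longrightarrow> (\<integral>\<omega>. \<Delta> k \<omega> \<partial>P) = 0"
    and var: "\<And>k. card B \<noteq> 1 \<Longrightarrow> k < I \<Longrightarrow> integrable P (\<lambda>\<omega>. (\<Delta> k \<omega>)\<^sup>2)"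
      "\<And>k. card B \<noteq> 1 \<Longrightarrow> k < I \<Longrightarrow> (\<integral>\<omega>. (\<Delta> k \<omega>)\<^sup>2 \<partial>P) \<le> \<sigma>\<^sup>2"
    and \<sigma>: "0 \<le> \<sigma>"
  shows "(\<integral>\<omega>. noise_majorant B (beta I) (\<lambda>k. \<Delta> k \<omega>) (I - 1) \<partial>P)
    \<le> 4 * sqrt (ln (real I + 1) / (real I + 1)) * \<sigma> * sqrt (real (card B) - 1)"
proof -
  interpret P: prob_space P by (rule P)
  note b = beta_bounds[OF I] and bp = beta_powers[OF I]
  have finB: "finite B" using B by (auto intro: finite_subset)
  define t where "t = ln (real I + 1) / (real I + 1)"
  show ?thesis
  proof (cases "card B = 1")
    case True
    then have B1: "B = {1}" using B by (auto simp: card_1_singleton_iff)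
    have "(\<integral>\<omega>. noise_majorant B (beta I) (\<lambda>k. \<Delta> k \<omega>) (0 + (I - 1)) \<partial>P)
      = beta I ^ (I - 1) * (\<integral>\<omega>. noise_majorant B (beta I) (\<lambda>k. \<Delta> k \<omega>) 0 \<partial>P)"
      using I mean B1 by (intro integral_noise_majorant_no_max) auto
    also have "\<dots> = 0" using mean I by simp
    finally show ?thesis using True by simp
  next
    case False
    have "1 \<le> card B" using B finB by (simp add: Suc_le_eq card_gt_0_iff) auto
    with False have card2: "2 \<le> card B" by simp
    have "card B \<le> I div 2" using card_mono[OF _ B(2)] by simp
    define m where "m = I div 2 - 1"
    have m: "I - 1 = m + (I - I div 2)" "Suc m = I div 2" "m < I"
      using card2 \<open>card B \<le> I div 2\<close> by (auto simp: m_def)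
    let ?a = "\<lambda>\<omega>. noise_majorant B (beta I) (\<lambda>k. \<Delta> k \<omega>) m"
    have "B \<inter> {1..Suc m} = B" using B m by auto
    then have second: "?a \<in> borel_measurable P" "integrable P (\<lambda>\<omega>. (?a \<omega>)\<^sup>2)"
      "(\<integral>\<omega>. (?a \<omega>)\<^sup>2 \<partial>P) \<le> real (card B) * \<sigma>\<^sup>2"
      using second_moment_noise_majorant[of "beta I" B "\<sigma>\<^sup>2" m \<Delta> P] b B meas var False m by auto
    have "(\<integral>\<omega>. ?a \<omega> \<partial>P) \<le> sqrt (\<integral>\<omega>. (?a \<omega>)\<^sup>2 \<partial>P)"
      by (rule P.expectation_le_sqrt_second_moment) (use second in auto)
    also have "\<dots> \<le> sqrt (real (card B) * \<sigma>\<^sup>2)" using second by simp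
    also have "\<dots> \<le> sqrt (2\<^sup>2 * (real (card B) - 1) * \<sigma>\<^sup>2)"
      using card2 by (intro real_sqrt_le_mono mult_right_mono) auto
    also have "\<dots> = 2 * sqrt (real (card B) - 1) * \<sigma>"
      using \<sigma> by (simp only: real_sqrt_mult real_sqrt_abs abs_of_nonneg abs_numeral)
    finally have le: "(\<integral>\<omega>. ?a \<omega> \<partial>P) \<le> 2 * sqrt (real (card B) - 1) * \<sigma>" .
    have "(\<integral>\<omega>. noise_majorant B (beta I) (\<lambda>k. \<Delta> k \<omega>) (I - 1) \<partial>P) = beta I ^ (I - I div 2) * (\<integral>\<omega>. ?a \<omega> \<partial>P)"
      unfolding m(1) using m B mean by (intro integral_noise_majorant_no_max) auto
    also have "\<dots> \<le> beta I ^ (I - I div 2) * (2 * sqrt (real (card B) - 1) * \<sigma>)"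
      using le b by (intro mult_left_mono) auto
    also have "\<dots> \<le> 2 * sqrt t * (2 * sqrt (real (card B) - 1) * \<sigma>)"
      using bp card2 \<sigma> by (intro mult_right_mono) (auto simp: t_def)
    finally show ?thesis by (simp add: t_def algebra_simps)
  qed
qed


section \<open>Independence of the iterates and the samples\<close>

text \<open>
  A variable that is determined by some of the samples is measurable for the
  \<open>\<sigma>\<close>-algebra they generate. That is expressed by its measurability for every \<open>\<sigma>\<close>-algebra for which
  they are measurable.
\<close>

lemma (in prob_space) joint_law_determined:
  fixes X :: "'i \<Rightarrow> 'a \<Rightarrow> 'b"
  assumes X: "indep_vars (\<lambda>_. Q) X K" and J: "J \<subseteq> K" and k: "k \<in> K" "k \<notin> J"
    and Z: "\<And>N. space N = space M \<Longrightarrow> (\<And>i. i \<in> J \<Longrightarrow> X i \<in> measurable N Q) \<Longrightarrow> Z \<in> measurable N R"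
  shows "random_variable R Z" "random_variable Q (X k)"
    "distr M R Z \<Otimes>\<^sub>M distr M Q (X k) = distr M (R \<Otimes>\<^sub>M Q) (\<lambda>\<omega>. (Z \<omega>, X k \<omega>))"
proof -
  define V where "V A \<omega> = restrict (\<lambda>i. X i \<omega>) A" for A \<omega>
  have rv: "\<And>i. i \<in> K \<Longrightarrow> random_variable Q (X i)"
    using X by (simp add: indep_vars_def2)
  have VX: "indep_var (PiM J (\<lambda>_. Q)) (V J) (PiM {k} (\<lambda>_. Q)) (V {k})"
    unfolding V_def using indep_var_restrict[OF X, of J "{k}"] J k by auto
  then have V: "random_variable (PiM J (\<lambda>_. Q)) (V J)" by (rule indep_var_rv1)
  define N where "N = vimage_algebra (space M) (V J) (PiM J (\<lambda>_. Q))"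
  have V_N: "V J \<in> measurable N (PiM J (\<lambda>_. Q))"
    unfolding N_def using measurable_space[OF V] by (intro measurable_vimage_algebra1) auto
  have Z_N: "Z \<in> measurable N R"
  proof (rule Z)
    fix i assume i: "i \<in> J"
    have "(\<lambda>\<omega>. V J \<omega> i) \<in> measurable N Q"
      using measurable_compose[OF V_N measurable_component_singleton[OF i]] .
    then show "X i \<in> measurable N Q" using i by (simp add: V_def)
  qed (simp add: N_def)
  have sets_N: "sets N = sigma_sets (space M) {V J -` A \<inter> space M | A. A \<in> sets (PiM J (\<lambda>_. Q))}"
    by (simp add: N_def sets_vimage_algebra)
  have space_N: "space N = space M" by (simp add: N_def)
  let ?K = "sigma_sets (space M) {V {k} -` A \<inter> space M | A. A \<in> sets (PiM {k} (\<lambda>_. Q))}"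
  have indep: "indep_set (sets N) ?K"
    using VX unfolding indep_var_eq sets_N by simp
  have "sets N \<subseteq> events" using indep by (rule indep_setD_ev1)
  then show Z_M: "random_variable R Z"
    using Z_N space_N by (auto simp: measurable_def)
  show X_M: "random_variable Q (X k)" using rv k by simp
  interpret Z: prob_space "distr M R Z" by (rule prob_space_distr[OF Z_M])
  interpret X: prob_space "distr M Q (X k)" by (rule prob_space_distr[OF X_M])
  show "distr M R Z \<Otimes>\<^sub>M distr M Q (X k) = distr M (R \<Otimes>\<^sub>M Q) (\<lambda>\<omega>. (Z \<omega>, X k \<omega>))"
  proof (rule pair_measure_eqI)
    show "sets (distr M R Z \<Otimes>\<^sub>M distr M Q (X k)) = sets (distr M (R \<Otimes>\<^sub>M Q) (\<lambda>\<omega>. (Z \<omega>, X k \<omega>)))"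
      by (simp cong: sets_pair_measure_cong)
  next
    fix A C assume "A \<in> sets (distr M R Z)" "C \<in> sets (distr M Q (X k))"
    then have A: "A \<in> sets R" and C: "C \<in> sets Q" by auto
    have "Z -` A \<inter> space M \<in> sets N"
      using measurable_sets[OF Z_N A] space_N by simp
    moreover have "X k -` C \<inter> space M \<in> ?K"
    proof -
      define C' where "C' = (\<lambda>v. v k) -` C \<inter> space (PiM {k} (\<lambda>_. Q))"
      have "C' \<in> sets (PiM {k} (\<lambda>_. Q))"
        unfolding C'_def using C by (intro measurable_sets[OF measurable_component_singleton]) auto
      moreover have "X k -` C \<inter> space M = V {k} -` C' \<inter> space M"
        using measurable_space[OF X_M] by (auto simp: C'_def V_def space_PiM)
      ultimately show ?thesis by (intro sigma_sets.Basic) auto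
    qed
    ultimately have "prob ((Z -` A \<inter> space M) \<inter> (X k -` C \<inter> space M)) =
        prob (Z -` A \<inter> space M) * prob (X k -` C \<inter> space M)"
      by (rule indep_setD[OF indep])
    moreover have "(Z -` A \<inter> space M) \<inter> (X k -` C \<inter> space M) =
        (\<lambda>\<omega>. (Z \<omega>, X k \<omega>)) -` (A \<times> C) \<inter> space M" by auto
    moreover have "(\<lambda>\<omega>. (Z \<omega>, X k \<omega>)) \<in> measurable M (R \<Otimes>\<^sub>M Q)"
      using Z_M X_M by (rule measurable_Pair)
    ultimately show "emeasure (distr M R Z) A * emeasure (distr M Q (X k)) C =
        emeasure (distr M (R \<Otimes>\<^sub>M Q) (\<lambda>\<omega>. (Z \<omega>, X k \<omega>))) (A \<times> C)"
      using A C Z_M X_M by (simp add: emeasure_distr emeasure_eq_measure ennreal_mult'')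
  qed unfold_locales
qed

context stochastic_composite
begin

lemma measurable_apply_sample:
  assumes g: "(\<lambda>(x, \<xi>). g x \<xi>) \<in> borel_measurable (dom_space \<Otimes>\<^sub>M Q)"
    and Z: "Z \<in> measurable N dom_space" and W: "W \<in> measurable N Q"
  shows "(\<lambda>p. g (Z p) (W p)) \<in> borel_measurable N"
  using measurable_compose[OF measurable_Pair[OF Z W] g] by simp

lemma borel_of_dom_space: "Z \<in> measurable N dom_space \<Longrightarrow> Z \<in> borel_measurable N"
  by (simp add: measurable_restrict_space2_iff)

lemma in_edom_of_dom_space: "Z \<in> measurable N dom_space \<Longrightarrow> p \<in> space N \<Longrightarrow> Z p \<in> edom h"
  by (simp add: measurable_restrict_space2_iff) blast

lemma measurable_cut_model_iterate:
  assumes x0: "x0 \<in> measurable N dom_space"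
    and W: "\<And>i. i < j \<Longrightarrow> W i \<in> measurable N Q"
  shows "(\<forall>u. (\<lambda>p. cut_model (x0 p) (\<lambda>i. W i p) j u) \<in> borel_measurable N) \<and>
    (\<lambda>p. iterate (x0 p) (\<lambda>i. W i p) j) \<in> measurable N dom_space"
  using W
proof (induction j rule: induct_nat_012)
  case 0
  then show ?case using x0 by (simp add: iterate_0)
next
  case 1
  have cutting: "(\<lambda>p. cutting_plane (x0 p) (W 0 p) u) \<in> borel_measurable N" for u
    unfolding cutting_plane_def using 1
    by (intro borel_measurable_add borel_measurable_inner borel_measurable_diff borel_measurable_const
        measurable_apply_sample[OF F_measurable] measurable_apply_sample[OF s_measurable]
        x0 borel_of_dom_space[OF x0]) auto
  then have model: "(\<lambda>p. cut_model (x0 p) (\<lambda>i. W i p) (Suc 0) u) \<in> borel_measurable N" for u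
    by simp
  moreover have "(\<lambda>p. iterate (x0 p) (\<lambda>i. W i p) (Suc 0)) \<in> borel_measurable N"
    unfolding iterate_Suc
    by (intro borel_measurable_prox_step h lam convex_on_cut_model model borel_of_dom_space[OF x0])
  ultimately show ?case
    using iterate_in_edom in_edom_of_dom_space[OF x0] by (auto intro!: measurable_restrict_space2)
next
  case (ge2 i)
  define Z where "Z = (\<lambda>p. iterate (x0 p) (\<lambda>i. W i p) (Suc i))"
  have Z: "Z \<in> measurable N dom_space" using ge2 by (simp add: Z_def)
  have cutting: "(\<lambda>p. cutting_plane (Z p) (W (Suc i) p) u) \<in> borel_measurable N" for u
    unfolding cutting_plane_def using ge2.prems
    by (intro borel_measurable_add borel_measurable_inner borel_measurable_diff borel_measurable_const
        measurable_apply_sample[OF F_measurable] measurable_apply_sample[OF s_measurable]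
        Z borel_of_dom_space[OF Z]) auto
  have IH: "(\<lambda>p. cut_model (x0 p) (\<lambda>i. W i p) (Suc i) u) \<in> borel_measurable N" for u
    using ge2 by simp
  have model: "(\<lambda>p. cut_model (x0 p) (\<lambda>i. W i p) (Suc (Suc i)) u) \<in> borel_measurable N" for u
    unfolding cut_model.simps using cutting IH
    by (cases "Suc (Suc i) \<in> B")
      (auto simp: Z_def intro!: borel_measurable_add borel_measurable_times borel_measurable_max)
  moreover have "(\<lambda>p. iterate (x0 p) (\<lambda>i. W i p) (Suc (Suc i))) \<in> borel_measurable N"
    unfolding iterate_Suc
    by (intro borel_measurable_prox_step h lam convex_on_cut_model model borel_of_dom_space[OF x0])
  ultimately show ?case
    using iterate_in_edom in_edom_of_dom_space[OF x0] by (auto intro!: measurable_restrict_space2)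
qed

lemma measurable_phival: "phival \<in> borel_measurable borel"
proof -
  have "fval \<in> borel_measurable borel" "hval \<in> borel_measurable borel"
    unfolding fval_def hval_def
    using borel_measurable_pcc[OF f] borel_measurable_pcc[OF h] by auto
  then show ?thesis unfolding phival_def by auto
qed

text \<open>A variable that is independent of a sample may be frozen while the sample is averaged out.\<close>

lemma
  assumes P: "prob_space P" and rv: "Z \<in> measurable P dom_space" "W \<in> measurable P Q"
    and joint: "distr P dom_space Z \<Otimes>\<^sub>M Q = distr P (dom_space \<Otimes>\<^sub>M Q) (\<lambda>\<omega>. (Z \<omega>, W \<omega>))"
  shows nn_integral_independent_sample:
      "(\<lambda>(x, \<xi>). g x \<xi>) \<in> borel_measurable (dom_space \<Otimes>\<^sub>M Q) \<Longrightarrow>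
        (\<integral>\<^sup>+\<omega>. g (Z \<omega>) (W \<omega>) \<partial>P) = (\<integral>\<^sup>+\<omega>. (\<integral>\<^sup>+\<xi>. g (Z \<omega>) \<xi> \<partial>Q) \<partial>P)"
    and integral_independent_sample:
      "integrable P (\<lambda>\<omega>. F (Z \<omega>) (W \<omega>)) \<Longrightarrow> integrable P (\<lambda>\<omega>. fval (Z \<omega>)) \<and>
        (\<integral>\<omega>. F (Z \<omega>) (W \<omega>) \<partial>P) = (\<integral>\<omega>. fval (Z \<omega>) \<partial>P)"
proof -
  interpret P: prob_space P by (rule P)
  interpret D: prob_space "distr P dom_space Z" by (rule P.prob_space_distr[OF rv(1)])
  interpret DQ: pair_prob_space "distr P dom_space Z" Q ..
  have pair: "(\<lambda>\<omega>. (Z \<omega>, W \<omega>)) \<in> measurable P (dom_space \<Otimes>\<^sub>M Q)"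
    using rv by (rule measurable_Pair)
  show "(\<integral>\<^sup>+\<omega>. g (Z \<omega>) (W \<omega>) \<partial>P) = (\<integral>\<^sup>+\<omega>. (\<integral>\<^sup>+\<xi>. g (Z \<omega>) \<xi> \<partial>Q) \<partial>P)"
    if g: "(\<lambda>(x, \<xi>). g x \<xi>) \<in> borel_measurable (dom_space \<Otimes>\<^sub>M Q)"
  proof -
    have "(\<integral>\<^sup>+\<omega>. g (Z \<omega>) (W \<omega>) \<partial>P) =
        (\<integral>\<^sup>+y. (case y of (x, \<xi>) \<Rightarrow> g x \<xi>) \<partial>distr P (dom_space \<Otimes>\<^sub>M Q) (\<lambda>\<omega>. (Z \<omega>, W \<omega>)))"
      by (subst nn_integral_distr[OF pair]) (use g in simp_all)
    also have "\<dots> = (\<integral>\<^sup>+x. (\<integral>\<^sup>+\<xi>. g x \<xi> \<partial>Q) \<partial>distr P dom_space Z)"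
      unfolding joint[symmetric] using nn_integral_fst[of "\<lambda>(x, \<xi>). g x \<xi>" "distr P dom_space Z"] g
      by (simp cong: measurable_cong_sets)
    also have "\<dots> = (\<integral>\<^sup>+\<omega>. (\<integral>\<^sup>+\<xi>. g (Z \<omega>) \<xi> \<partial>Q) \<partial>P)"
      using borel_measurable_nn_integral_fst[OF g] by (intro nn_integral_distr[OF rv(1)]) simp
    finally show ?thesis .
  qed
  assume int: "integrable P (\<lambda>\<omega>. F (Z \<omega>) (W \<omega>))"
  have fval_eq: "(\<integral>\<xi>. F x \<xi> \<partial>Q) = fval x" if "x \<in> space dom_space" for x
    using F_integrable(2)[of x] that by (simp add: space_restrict_space)
  have int_prod: "integrable (distr P dom_space Z \<Otimes>\<^sub>M Q) (\<lambda>(x, \<xi>). F x \<xi>)"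
    unfolding joint using int by (simp add: integrable_distr_eq[OF pair F_measurable])
  have meas: "(\<lambda>x. \<integral>\<xi>. F x \<xi> \<partial>Q) \<in> borel_measurable dom_space"
    using borel_measurable_lebesgue_integral[OF F_measurable] .
  have "integrable (distr P dom_space Z) (\<lambda>x. \<integral>\<xi>. F x \<xi> \<partial>Q)"
    using DQ.integrable_fst'[OF int_prod] by simp
  then have "integrable P (\<lambda>\<omega>. \<integral>\<xi>. F (Z \<omega>) \<xi> \<partial>Q)"
    by (simp add: integrable_distr_eq[OF rv(1) meas])
  then have 1: "integrable P (\<lambda>\<omega>. fval (Z \<omega>))"
    using fval_eq measurable_space[OF rv(1)] by (simp cong: Bochner_Integration.integrable_cong)
  have "(\<integral>\<omega>. F (Z \<omega>) (W \<omega>) \<partial>P) = (\<integral>y. (case y of (x, \<xi>) \<Rightarrow> F x \<xi>) \<partial>(distr P dom_space Z \<Otimes>\<^sub>M Q))"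
    unfolding joint using integral_distr[OF pair F_measurable] by simp
  also have "\<dots> = (\<integral>x. (\<integral>\<xi>. F x \<xi> \<partial>Q) \<partial>distr P dom_space Z)"
    using DQ.integral_fst'[OF int_prod] by simp
  also have "\<dots> = (\<integral>\<omega>. (\<integral>\<xi>. F (Z \<omega>) \<xi> \<partial>Q) \<partial>P)"
    by (rule integral_distr[OF rv(1) meas])
  also have "\<dots> = (\<integral>\<omega>. fval (Z \<omega>) \<partial>P)"
    using fval_eq measurable_space[OF rv(1)] by (intro Bochner_Integration.integral_cong) auto
  finally show "integrable P (\<lambda>\<omega>. fval (Z \<omega>)) \<and> (\<integral>\<omega>. F (Z \<omega>) (W \<omega>) \<partial>P) = (\<integral>\<omega>. fval (Z \<omega>) \<partial>P)"
    using 1 by simp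
qed

end



section \<open>One call with a random centre\<close>

text \<open>
  The comparison point \<open>u\<close> is a minimizer, so that every objective value is bounded below and an
  upper bound for an average of them makes the average integrable.
\<close>

locale stochastic_call =
  stochastic_composite Q f h F s M lam I B + P: prob_space P
  for Q :: "'b measure" and f h :: "'a::euclidean_space \<Rightarrow> ereal" and F s M lam I B
    and P :: "'w measure" +
  fixes x0 :: "'w \<Rightarrow> 'a" and W :: "nat \<Rightarrow> 'w \<Rightarrow> 'b" and u :: 'a
  assumes x0: "x0 \<in> measurable P dom_space"
    and W: "\<And>j. j \<le> I \<Longrightarrow> W j \<in> measurable P Q"
    and law: "\<And>j. j \<le> I \<Longrightarrow> distr P Q (W j) = Q"
    and joint: "\<And>j. j \<le> I \<Longrightarrow>
      distr P dom_space (\<lambda>\<omega>. iterate (x0 \<omega>) (\<lambda>i. W i \<omega>) j) \<Otimes>\<^sub>M Q =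
      distr P (dom_space \<Otimes>\<^sub>M Q) (\<lambda>\<omega>. (iterate (x0 \<omega>) (\<lambda>i. W i \<omega>) j, W j \<omega>))"
    and u: "u \<in> edom h"
    and u_min: "\<And>x. x \<in> edom h \<Longrightarrow> phival u \<le> phival x"
    and x0_dist: "integrable P (\<lambda>\<omega>. (norm (u - x0 \<omega>))\<^sup>2)"
begin

definition Z :: "nat \<Rightarrow> 'w \<Rightarrow> 'a" where
  "Z j \<omega> = iterate (x0 \<omega>) (\<lambda>i. W i \<omega>) j"

definition err :: "nat \<Rightarrow> 'w \<Rightarrow> real" where
  "err j \<omega> = F (Z j \<omega>) (W j \<omega>) - fval (Z j \<omega>)"

definition pen :: "nat \<Rightarrow> 'w \<Rightarrow> real" where
  "pen j \<omega> = step_penalty (x0 \<omega>) (\<lambda>i. W i \<omega>) j"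

lemma Z_0: "Z 0 = x0"
  by (rule ext) (simp add: Z_def iterate_0)

lemma Z_measurable: "j \<le> I \<Longrightarrow> Z j \<in> measurable P dom_space"
  using measurable_cut_model_iterate[OF x0, of j W] W unfolding Z_def[abs_def] by auto

lemma Z_in_edom: "\<omega> \<in> space P \<Longrightarrow> Z j \<omega> \<in> edom h"
  unfolding Z_def by (intro iterate_in_edom in_edom_of_dom_space[OF x0])

lemma pen_eq:
  "pen j \<omega> = - err j \<omega> + lam / 2 * (if j = 0 then 1 else (1 - b) / b) * (M + norm (s (Z j \<omega>) (W j \<omega>)))\<^sup>2"
  by (simp add: pen_def step_penalty_def sample_error_def err_def Z_def)

lemma AE_subgradient: "AE \<omega> in P. \<forall>k\<le>I. subgradient_sample (W k \<omega>)"
proof -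
  have "AE \<omega> in P. subgradient_sample (W k \<omega>)" if "k \<in> {..I}" for k
  proof (rule AE_distrD[where M = P and M' = Q and f = "W k"])
    show "W k \<in> measurable P Q" using W that by auto
    show "AE \<xi> in distr P Q (W k). subgradient_sample \<xi>"
      unfolding law[of k, OF that[unfolded atMost_iff]] subgradient_sample_def
      by (rule s_subgradient)
  qed
  then have "AE \<omega> in P. \<forall>k\<in>{..I}. subgradient_sample (W k \<omega>)"
    by (intro AE_finite_allI) auto
  then show ?thesis by (rule eventually_mono) auto
qed

lemma integrable_of_law:
  fixes g :: "'b \<Rightarrow> real"
  assumes j: "j \<le> I" and g: "integrable Q g"
  shows "integrable P (\<lambda>\<omega>. g (W j \<omega>))" "(\<integral>\<omega>. g (W j \<omega>) \<partial>P) = integral\<^sup>L Q g"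
proof -
  have meas: "g \<in> borel_measurable Q" using g by auto
  show "integrable P (\<lambda>\<omega>. g (W j \<omega>))"
    using integrable_distr_eq[OF W[OF j] meas] law[OF j] g by simp
  show "(\<integral>\<omega>. g (W j \<omega>) \<partial>P) = integral\<^sup>L Q g"
    using integral_distr[OF W[OF j] meas] law[OF j] by simp
qed

lemma s_measurable_along:
  assumes j: "j \<le> I"
  shows "(\<lambda>\<omega>. norm (s (Z j \<omega>) (W j \<omega>))) \<in> borel_measurable P"
  using measurable_apply_sample[OF s_measurable Z_measurable[OF j] W[OF j]] by auto

lemma s_moment_along:
  assumes j: "j \<le> I"
  shows "integrable P (\<lambda>\<omega>. (norm (s (Z j \<omega>) (W j \<omega>)))\<^sup>2)"
    and "(\<integral>\<omega>. (norm (s (Z j \<omega>) (W j \<omega>)))\<^sup>2 \<partial>P) \<le> M\<^sup>2"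
proof -
  note [measurable] = s_measurable_along[OF j]
  have g: "(\<lambda>(x, \<xi>). ennreal ((norm (s x \<xi>))\<^sup>2)) \<in> borel_measurable (dom_space \<Otimes>\<^sub>M Q)"
  proof -
    have "(\<lambda>y. ennreal ((norm (case y of (x, \<xi>) \<Rightarrow> s x \<xi>))\<^sup>2)) \<in> borel_measurable (dom_space \<Otimes>\<^sub>M Q)"
      using s_measurable by measurable
    then show ?thesis by (simp add: case_prod_beta')
  qed
  have "(\<integral>\<^sup>+\<omega>. ennreal ((norm (s (Z j \<omega>) (W j \<omega>)))\<^sup>2) \<partial>P) =
      (\<integral>\<^sup>+\<omega>. (\<integral>\<^sup>+\<xi>. ennreal ((norm (s (Z j \<omega>) \<xi>))\<^sup>2) \<partial>Q) \<partial>P)"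
    using nn_integral_independent_sample[OF P.prob_space_axioms Z_measurable[OF j] W[OF j] _ g]
      joint[OF j] unfolding Z_def[abs_def] by simp
  also have "\<dots> \<le> (\<integral>\<^sup>+\<omega>. ennreal (M\<^sup>2) \<partial>P)"
    by (intro nn_integral_mono s_second_moment Z_in_edom)
  also have "\<dots> = ennreal (M\<^sup>2)" by (simp add: P.emeasure_space_1)
  finally have le: "(\<integral>\<^sup>+\<omega>. ennreal ((norm (s (Z j \<omega>) (W j \<omega>)))\<^sup>2) \<partial>P) \<le> ennreal (M\<^sup>2)" .
  then show int: "integrable P (\<lambda>\<omega>. (norm (s (Z j \<omega>) (W j \<omega>)))\<^sup>2)"
    by (intro integrableI_nonneg) (auto intro: le_less_trans)
  show "(\<integral>\<omega>. (norm (s (Z j \<omega>) (W j \<omega>)))\<^sup>2 \<partial>P) \<le> M\<^sup>2"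
    using le nn_integral_eq_integral[OF int] by simp
qed

text \<open>
  The subgradient inequalities at \<open>Z j\<close> and at \<open>u\<close> bound the difference of the sampled values by
  products of square integrable variables.
\<close>

lemma err_of_square_integrable:
  assumes j: "j \<le> I" and dist: "integrable P (\<lambda>\<omega>. (norm (u - Z j \<omega>))\<^sup>2)"
  shows "integrable P (err j)" "(\<integral>\<omega>. err j \<omega> \<partial>P) = 0"
proof -
  define S S' d where "S \<omega> = norm (s (Z j \<omega>) (W j \<omega>))" and "S' \<omega> = norm (s u (W j \<omega>))"
    and "d \<omega> = norm (u - Z j \<omega>)" for \<omega>
  define G where "G \<omega> = \<bar>F u (W j \<omega>)\<bar> + ((S \<omega>)\<^sup>2 + (S' \<omega>)\<^sup>2 + (d \<omega>)\<^sup>2)" for \<omega>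
  have G: "integrable P G"
    unfolding G_def S_def S'_def d_def
    using integrable_of_law(1)[OF j F_integrable(1)[OF u]] s_moment_along[OF j] dist
      integrable_of_law(1)[OF j s_square_integrable(1)[OF u]]
    by (intro Bochner_Integration.integrable_add integrable_abs)
  have F_int: "integrable P (\<lambda>\<omega>. F (Z j \<omega>) (W j \<omega>))"
  proof (rule Bochner_Integration.integrable_bound[OF G])
    show "(\<lambda>\<omega>. F (Z j \<omega>) (W j \<omega>)) \<in> borel_measurable P"
      by (rule measurable_apply_sample[OF F_measurable Z_measurable[OF j] W[OF j]])
    show "AE \<omega> in P. norm (F (Z j \<omega>) (W j \<omega>)) \<le> norm (G \<omega>)"
      using AE_subgradient AE_space
    proof eventually_elim
      case (elim \<omega>)
      have z: "Z j \<omega> \<in> edom h" using elim Z_in_edom by auto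
      have sub: "F u (W j \<omega>) \<ge> F (Z j \<omega>) (W j \<omega>) + s (Z j \<omega>) (W j \<omega>) \<bullet> (u - Z j \<omega>)"
        "F (Z j \<omega>) (W j \<omega>) \<ge> F u (W j \<omega>) + s u (W j \<omega>) \<bullet> (Z j \<omega> - u)"
        using elim j u z by (auto simp: subgradient_sample_def)
      have "\<bar>s (Z j \<omega>) (W j \<omega>) \<bullet> (u - Z j \<omega>)\<bar> \<le> S \<omega> * d \<omega>"
        "\<bar>s u (W j \<omega>) \<bullet> (Z j \<omega> - u)\<bar> \<le> S' \<omega> * d \<omega>"
        using Cauchy_Schwarz_ineq2[of "s (Z j \<omega>) (W j \<omega>)" "u - Z j \<omega>"]
          Cauchy_Schwarz_ineq2[of "s u (W j \<omega>)" "Z j \<omega> - u"]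
        by (auto simp: S_def S'_def d_def norm_minus_commute)
      moreover have "S \<omega> * d \<omega> \<le> (S \<omega>)\<^sup>2 + (S' \<omega>)\<^sup>2 + (d \<omega>)\<^sup>2"
        "S' \<omega> * d \<omega> \<le> (S \<omega>)\<^sup>2 + (S' \<omega>)\<^sup>2 + (d \<omega>)\<^sup>2"
        using sum_squares_bound[of "S \<omega>" "d \<omega>"] sum_squares_bound[of "S' \<omega>" "d \<omega>"]
          zero_le_power2[of "S \<omega>"] zero_le_power2[of "S' \<omega>"] zero_le_power2[of "d \<omega>"]
        by linarith+
      ultimately have "\<bar>F (Z j \<omega>) (W j \<omega>)\<bar> \<le> G \<omega>"
        using sub unfolding G_def by linarith
      then show ?case by simp
    qed
  qed
  have "integrable P (\<lambda>\<omega>. fval (Z j \<omega>)) \<and> (\<integral>\<omega>. F (Z j \<omega>) (W j \<omega>) \<partial>P) = (\<integral>\<omega>. fval (Z j \<omega>) \<partial>P)"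
    using joint[OF j] F_int unfolding Z_def[abs_def]
    by (intro integral_independent_sample[OF P.prob_space_axioms _ W[OF j]]
        Z_measurable[OF j, unfolded Z_def[abs_def]])
  with F_int show "integrable P (err j)" "(\<integral>\<omega>. err j \<omega> \<partial>P) = 0"
    unfolding err_def[abs_def] by auto
qed

lemma pen_of_err:
  assumes j: "j \<le> I" and err: "integrable P (err j)" "(\<integral>\<omega>. err j \<omega> \<partial>P) = 0"
  shows "integrable P (pen j)"
    and "(\<integral>\<omega>. pen j \<omega> \<partial>P) \<le> 2 * lam * M\<^sup>2 * (if j = 0 then 1 else (1 - b) / b)"
proof -
  define S where "S \<omega> = norm (s (Z j \<omega>) (W j \<omega>))" for \<omega>
  define k where "k = (if j = 0 then 1 else (1 - b) / b)"
  have k: "0 \<le> k" using b by (simp add: k_def)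
  note [measurable] = s_measurable_along[OF j, folded S_def]
  have S: "integrable P (\<lambda>\<omega>. (S \<omega>)\<^sup>2)" "(\<integral>\<omega>. (S \<omega>)\<^sup>2 \<partial>P) \<le> M\<^sup>2"
    using s_moment_along[OF j] by (auto simp: S_def)
  have le: "(M + S \<omega>)\<^sup>2 \<le> 2 * M\<^sup>2 + 2 * (S \<omega>)\<^sup>2" for \<omega>
    using sum_squares_bound[of M "S \<omega>"] by (simp add: power2_sum)
  have int2: "integrable P (\<lambda>\<omega>. 2 * M\<^sup>2 + 2 * (S \<omega>)\<^sup>2)" using S by auto
  have int1: "integrable P (\<lambda>\<omega>. (M + S \<omega>)\<^sup>2)"
    by (rule Bochner_Integration.integrable_bound[OF int2])
      (use le in \<open>auto intro!: AE_I2 order_trans[OF le abs_ge_self]\<close>)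
  have "(\<integral>\<omega>. (M + S \<omega>)\<^sup>2 \<partial>P) \<le> (\<integral>\<omega>. 2 * M\<^sup>2 + 2 * (S \<omega>)\<^sup>2 \<partial>P)"
    by (intro integral_mono int1 int2 le)
  also have "\<dots> \<le> 4 * M\<^sup>2" using S by (simp add: P.prob_space)
  finally have "lam / 2 * k * (\<integral>\<omega>. (M + S \<omega>)\<^sup>2 \<partial>P) \<le> lam / 2 * k * (4 * M\<^sup>2)"
    using lam k by (intro mult_left_mono) auto
  moreover have pen: "pen j = (\<lambda>\<omega>. - err j \<omega> + lam / 2 * k * (M + S \<omega>)\<^sup>2)"
    by (rule ext) (simp add: pen_eq k_def S_def)
  ultimately show "integrable P (pen j)"
    and "(\<integral>\<omega>. pen j \<omega> \<partial>P) \<le> 2 * lam * M\<^sup>2 * (if j = 0 then 1 else (1 - b) / b)"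
    using err int1 by (auto simp: algebra_simps simp flip: k_def)
qed

definition sample_noise :: "nat \<Rightarrow> 'w \<Rightarrow> real" where
  "sample_noise k \<omega> = F u (W k \<omega>) - fval u"

lemma sample_noise_integrable:
  assumes "k \<le> I"
  shows "integrable P (sample_noise k)" "(\<integral>\<omega>. sample_noise k \<omega> \<partial>P) = 0"
  using integrable_of_law[OF assms F_integrable(1)[OF u]] F_integrable(2)[OF u]
  unfolding sample_noise_def[abs_def] by (auto simp: P.prob_space)

definition path_bound :: "nat \<Rightarrow> 'w \<Rightarrow> real" where
  "path_bound i \<omega> = phival u + running_avg b (\<lambda>k. pen k \<omega>) i
    + noise_majorant B b (\<lambda>k. sample_noise k \<omega>) i + (norm (u - x0 \<omega>))\<^sup>2 / (2 * lam)"

lemma AE_path_bound: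
  assumes "i < I"
  shows "AE \<omega> in P. running_avg b (\<lambda>k. phival (Z (Suc k) \<omega>)) i
    + (norm (u - Z (Suc i) \<omega>))\<^sup>2 / (2 * lam) \<le> path_bound i \<omega>"
  using AE_subgradient AE_space
proof eventually_elim
  case (elim \<omega>)
  then show ?case
    using path_inequality[OF in_edom_of_dom_space[OF x0] u, of \<omega> i "\<lambda>i. W i \<omega>"] assms
    by (simp add: path_bound_def pen_def[abs_def] sample_noise_def Z_def)
qed

lemma average_ge_minimum:
  "\<omega> \<in> space P \<Longrightarrow> phival u \<le> running_avg b (\<lambda>k. phival (Z (Suc k) \<omega>)) i"
  using running_avg_mono[of b i "\<lambda>_. phival u" "\<lambda>k. phival (Z (Suc k) \<omega>)"] b u_min Z_in_edom
  by (simp add: running_avg_const)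

lemma integrable_path_bound:
  assumes "i < I" and err: "\<And>k. k \<le> i \<Longrightarrow> integrable P (err k) \<and> (\<integral>\<omega>. err k \<omega> \<partial>P) = 0"
  shows "integrable P (path_bound i)"
proof -
  have "integrable P (\<lambda>\<omega>. running_avg b (\<lambda>k. pen k \<omega>) i)"
    by (rule integrable_running_avg) (use assms pen_of_err in auto)
  moreover have "integrable P (\<lambda>\<omega>. noise_majorant B b (\<lambda>k. sample_noise k \<omega>) i)"
    by (rule integrable_noise_majorant) (use assms sample_noise_integrable in auto)
  ultimately show ?thesis
    unfolding path_bound_def[abs_def] using x0_dist by auto
qed

text \<open>
  The inequality for the first iterates bounds the distance of the next one to \<open>u\<close> by variables that
  involve only earlier errors; so the distances and the errors are treated by a joint induction.
\<close>

lemma iterate_moments: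
  "j \<le> I \<Longrightarrow> integrable P (\<lambda>\<omega>. (norm (u - Z j \<omega>))\<^sup>2) \<and> integrable P (err j) \<and> (\<integral>\<omega>. err j \<omega> \<partial>P) = 0"
proof (induction j rule: less_induct)
  case (less j)
  have "integrable P (\<lambda>\<omega>. (norm (u - Z j \<omega>))\<^sup>2)"
  proof (cases j)
    case 0
    then show ?thesis using x0_dist by (simp add: Z_0)
  next
    case (Suc i)
    have i: "i < I" using less.prems Suc by simp
    have int: "integrable P (\<lambda>\<omega>. 2 * lam * (path_bound i \<omega> - phival u))"
      using integrable_path_bound[OF i] less.IH less.prems Suc by auto
    show ?thesis
    proof (rule Bochner_Integration.integrable_bound[OF int])
      show "(\<lambda>\<omega>. (norm (u - Z j \<omega>))\<^sup>2) \<in> borel_measurable P"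
        using borel_of_dom_space[OF Z_measurable[OF less.prems]] by measurable
      show "AE \<omega> in P. norm ((norm (u - Z j \<omega>))\<^sup>2) \<le> norm (2 * lam * (path_bound i \<omega> - phival u))"
        using AE_path_bound[OF i] AE_space
      proof eventually_elim
        case (elim \<omega>)
        then have "(norm (u - Z j \<omega>))\<^sup>2 / (2 * lam) \<le> path_bound i \<omega> - phival u"
          using average_ge_minimum[of \<omega> i] Suc by simp
        then have "(norm (u - Z j \<omega>))\<^sup>2 \<le> 2 * lam * (path_bound i \<omega> - phival u)"
          using lam by (simp add: field_simps)
        then show ?case by simp
      qed
    qed
  qed
  with err_of_square_integrable[OF less.prems] show ?case by auto
qed

text \<open>
  The first penalty has weight \<open>\<beta>\<^bsup>I - 1\<^esup>\<close> in the average, and the others together at most 1; that is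
  the origin of the two summands in the factor of \<open>2 \<lambda> M\<^sup>2\<close>.
\<close>

lemma average_value:
  "integrable P (\<lambda>\<omega>. running_avg b (\<lambda>k. phival (Z (Suc k) \<omega>)) (I - 1))"
  "(\<integral>\<omega>. running_avg b (\<lambda>k. phival (Z (Suc k) \<omega>)) (I - 1) \<partial>P)
      + (\<integral>\<omega>. (norm (u - Z I \<omega>))\<^sup>2 \<partial>P) / (2 * lam)
    \<le> phival u + 2 * lam * M\<^sup>2 * (b ^ (I - 1) + (1 - b) / b)
      + (\<integral>\<omega>. noise_majorant B b (\<lambda>k. sample_noise k \<omega>) (I - 1) \<partial>P)
      + (\<integral>\<omega>. (norm (u - x0 \<omega>))\<^sup>2 \<partial>P) / (2 * lam)"
proof -
  have i: "I - 1 < I" "Suc (I - 1) = I" using I by auto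
  let ?T = "\<lambda>\<omega>. running_avg b (\<lambda>k. phival (Z (Suc k) \<omega>)) (I - 1)"
  have bound_int: "integrable P (path_bound (I - 1))"
    by (rule integrable_path_bound) (use i iterate_moments in auto)
  have T_meas: "(\<lambda>\<omega>. running_avg b (\<lambda>k. phival (Z (Suc k) \<omega>)) n) \<in> borel_measurable P" if "n < I" for n
    using that
  proof (induction n)
    case (Suc n)
    have "(\<lambda>\<omega>. phival (Z (Suc (Suc n)) \<omega>)) \<in> borel_measurable P"
      using borel_of_dom_space[OF Z_measurable[of "Suc (Suc n)"]] Suc
      by (intro measurable_compose[OF _ measurable_phival]) auto
    with Suc show ?case by auto
  next
    case 0
    have "(\<lambda>\<omega>. phival (Z (Suc 0) \<omega>)) \<in> borel_measurable P"
      using borel_of_dom_space[OF Z_measurable[of "Suc 0"]] 0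
      by (intro measurable_compose[OF _ measurable_phival]) auto
    then show ?case by auto
  qed
  show T: "integrable P ?T"
  proof (rule Bochner_Integration.integrable_bound)
    show "integrable P (\<lambda>\<omega>. \<bar>path_bound (I - 1) \<omega>\<bar> + \<bar>phival u\<bar>)"
      using bound_int by auto
    show "AE \<omega> in P. norm (?T \<omega>) \<le> norm (\<bar>path_bound (I - 1) \<omega>\<bar> + \<bar>phival u\<bar>)"
      using AE_path_bound[OF i(1)] AE_space
    proof eventually_elim
      case (elim \<omega>)
      moreover have "0 \<le> (norm (u - Z (Suc (I - 1)) \<omega>))\<^sup>2 / (2 * lam)" using lam by simp
      ultimately show ?case using average_ge_minimum[of \<omega> "I - 1"] unfolding real_norm_def by linarith
    qed
  qed (rule T_meas[OF i(1)])
  have pen_int: "integrable P (pen k)"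
    and pen_le: "(\<integral>\<omega>. pen k \<omega> \<partial>P) \<le> (if k = 0 then 2 * lam * M\<^sup>2 else 2 * lam * M\<^sup>2 * ((1 - b) / b))"
    if "k \<le> I" for k
    using pen_of_err[OF that] iterate_moments[OF that] by auto
  have "(\<integral>\<omega>. running_avg b (\<lambda>k. pen k \<omega>) (I - 1) \<partial>P) = running_avg b (\<lambda>k. \<integral>\<omega>. pen k \<omega> \<partial>P) (I - 1)"
    by (rule integrable_running_avg) (use pen_int in auto)
  also have "\<dots> \<le> running_avg b (\<lambda>k. if k = 0 then 2 * lam * M\<^sup>2 else 2 * lam * M\<^sup>2 * ((1 - b) / b)) (I - 1)"
    using b by (intro running_avg_mono pen_le) auto
  also have "\<dots> = b ^ (I - 1) * (2 * lam * M\<^sup>2) + (1 - b ^ (I - 1)) * (2 * lam * M\<^sup>2 * ((1 - b) / b))"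
    by (rule running_avg_first)
  also have "\<dots> \<le> b ^ (I - 1) * (2 * lam * M\<^sup>2) + 1 * (2 * lam * M\<^sup>2 * ((1 - b) / b))"
    using b lam by (intro add_left_mono mult_right_mono) auto
  also have "\<dots> = 2 * lam * M\<^sup>2 * (b ^ (I - 1) + (1 - b) / b)"
    by (simp add: distrib_left)
  finally have pen_sum: "(\<integral>\<omega>. running_avg b (\<lambda>k. pen k \<omega>) (I - 1) \<partial>P)
      \<le> 2 * lam * M\<^sup>2 * (b ^ (I - 1) + (1 - b) / b)" .
  have int1: "integrable P (\<lambda>\<omega>. (norm (u - Z I \<omega>))\<^sup>2)"
    using iterate_moments[of I] by simp
  have "(\<integral>\<omega>. ?T \<omega> + (norm (u - Z I \<omega>))\<^sup>2 / (2 * lam) \<partial>P) \<le> (\<integral>\<omega>. path_bound (I - 1) \<omega> \<partial>P)"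
    using AE_path_bound[OF i(1)] i T int1 bound_int by (intro integral_mono_AE) auto
  moreover have "(\<integral>\<omega>. path_bound (I - 1) \<omega> \<partial>P) = phival u
      + (\<integral>\<omega>. running_avg b (\<lambda>k. pen k \<omega>) (I - 1) \<partial>P)
      + (\<integral>\<omega>. noise_majorant B b (\<lambda>k. sample_noise k \<omega>) (I - 1) \<partial>P)
      + (\<integral>\<omega>. (norm (u - x0 \<omega>))\<^sup>2 \<partial>P) / (2 * lam)"
  proof -
    have "integrable P (\<lambda>\<omega>. running_avg b (\<lambda>k. pen k \<omega>) (I - 1))"
      by (rule integrable_running_avg) (use pen_int in auto)
    moreover have "integrable P (\<lambda>\<omega>. noise_majorant B b (\<lambda>k. sample_noise k \<omega>) (I - 1))"
      by (rule integrable_noise_majorant) (use sample_noise_integrable in auto)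
    ultimately show ?thesis
      unfolding path_bound_def using x0_dist by (simp add: P.prob_space)
  qed
  ultimately show "(\<integral>\<omega>. ?T \<omega> \<partial>P) + (\<integral>\<omega>. (norm (u - Z I \<omega>))\<^sup>2 \<partial>P) / (2 * lam)
    \<le> phival u + 2 * lam * M\<^sup>2 * (b ^ (I - 1) + (1 - b) / b)
      + (\<integral>\<omega>. noise_majorant B b (\<lambda>k. sample_noise k \<omega>) (I - 1) \<partial>P)
      + (\<integral>\<omega>. (norm (u - x0 \<omega>))\<^sup>2 \<partial>P) / (2 * lam)"
    using pen_sum T int1 by simp
qed

text \<open>The outputs use sampled values, whose errors have mean zero.\<close>

lemma average_sampled_value:
  "integrable P (\<lambda>\<omega>. running_avg b (\<lambda>k. phival (Z (Suc k) \<omega>) + err (Suc k) \<omega>) (I - 1))"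
  "(\<integral>\<omega>. running_avg b (\<lambda>k. phival (Z (Suc k) \<omega>) + err (Suc k) \<omega>) (I - 1) \<partial>P) =
    (\<integral>\<omega>. running_avg b (\<lambda>k. phival (Z (Suc k) \<omega>)) (I - 1) \<partial>P)"
proof -
  have int: "integrable P (err (Suc k))" "(\<integral>\<omega>. err (Suc k) \<omega> \<partial>P) = 0" if "k \<le> I - 1" for k
    using iterate_moments[of "Suc k"] that I by auto
  have "running_avg b (\<lambda>k. \<integral>\<omega>. err (Suc k) \<omega> \<partial>P) (I - 1) = 0"
  proof -
    have "running_avg b (\<lambda>k. \<integral>\<omega>. err (Suc k) \<omega> \<partial>P) (I - 1) = running_avg b (\<lambda>_. 0) (I - 1)"
      using b int by (intro antisym running_avg_mono) auto
    then show ?thesis by (simp add: running_avg_const)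
  qed
  then show "integrable P (\<lambda>\<omega>. running_avg b (\<lambda>k. phival (Z (Suc k) \<omega>) + err (Suc k) \<omega>) (I - 1))"
    "(\<integral>\<omega>. running_avg b (\<lambda>k. phival (Z (Suc k) \<omega>) + err (Suc k) \<omega>) (I - 1) \<partial>P) =
    (\<integral>\<omega>. running_avg b (\<lambda>k. phival (Z (Suc k) \<omega>)) (I - 1) \<partial>P)"
    using integrable_running_avg[of "I - 1" P "\<lambda>k. err (Suc k)" b] int average_value(1)
    by (auto simp: running_avg_add)
qed

end

context stochastic_composite
begin

lemma smax_u_eq:
  assumes z0: "z0 \<in> edom h"
  shows "smax_u h F s lam I B z0 w (Suc i) = ereal (running_avg b
    (\<lambda>k. phival (iterate z0 w (Suc k)) + sample_error z0 w (Suc k)) i)"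
proof -
  have eq: "Phi h F (iterate z0 w j) \<xi> = ereal (F (iterate z0 w j) \<xi> + hval (iterate z0 w j))" for j \<xi>
    by (simp add: Phi_def hval[OF iterate_in_edom[OF z0]])
  have "smax_u h F s lam I B z0 w (Suc i) = ereal (running_avg b
      (\<lambda>k. F (iterate z0 w (Suc k)) (w (Suc k)) + hval (iterate z0 w (Suc k))) i)"
    by (induction i) (simp_all add: eq)
  then show ?thesis
    by (simp add: phival_def sample_error_def add.commute)
qed

lemma convex_on_phival: "convex_on (edom h) phival"
proof -
  have "convex_on (edom h) hval"
    unfolding hval_def by (rule convex_on_pcc[OF h])
  moreover from this have "convex (edom h)" by (simp add: convex_on_def)
  with dom have "convex_on (edom h) fval"
    unfolding fval_def by (rule convex_on_subset[OF convex_on_pcc[OF f]])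
  ultimately show ?thesis
    unfolding phival_def by (intro convex_on_add)
qed

lemma smax_za_value:
  assumes z0: "z0 \<in> edom h"
  shows "smax_za h F s lam I B z0 w (Suc i) \<in> edom h \<and>
    phival (smax_za h F s lam I B z0 w (Suc i)) \<le> running_avg b (\<lambda>k. phival (iterate z0 w (Suc k))) i"
proof (induction i)
  case 0
  show ?case using iterate_in_edom[OF z0] by simp
next
  case (Suc i)
  define x y where "x = iterate z0 w (Suc (Suc i))" and "y = smax_za h F s lam I B z0 w (Suc i)"
  have xy: "x \<in> edom h" "y \<in> edom h"
    using Suc iterate_in_edom[OF z0] by (auto simp: x_def y_def)
  have za: "smax_za h F s lam I B z0 w (Suc (Suc i)) = (1 - b) *\<^sub>R x + b *\<^sub>R y"
    by (simp add: x_def y_def)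
  have "(1 - b) *\<^sub>R x + b *\<^sub>R y \<in> edom h"
    using convex_on_phival b xy by (intro convexD) (auto simp: convex_on_def)
  moreover have "phival ((1 - b) *\<^sub>R x + b *\<^sub>R y) \<le> (1 - b) * phival x + b * phival y"
    using convex_on_phival b xy by (intro convex_onD) auto
  moreover have "b * phival y \<le> b * running_avg b (\<lambda>k. phival (iterate z0 w (Suc k))) i"
    using Suc b by (intro mult_left_mono) (auto simp: y_def)
  ultimately show ?case unfolding za by (auto simp: x_def)
qed

end



section \<open>Restarted calls\<close>

locale stochastic_restarts =
  stochastic_composite Q f h F s M lam I B + P: prob_space P
  for Q :: "'b measure" and f h :: "'a::euclidean_space \<Rightarrow> ereal" and F s M lam I B
    and P :: "'w measure" +
  fixes X :: "nat \<Rightarrow> nat \<Rightarrow> 'w \<Rightarrow> 'b" and N :: nat and z0 u :: 'a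
  assumes X_indep: "P.indep_vars (\<lambda>_. Q) (\<lambda>(l, j). X l j) ({1..N} \<times> {0..I})"
    and X_law: "\<forall>l\<in>{1..N}. \<forall>j\<in>{0..I}. distr P Q (X l j) = Q"
    and z0: "z0 \<in> edom h"
    and u: "u \<in> edom h"
    and u_min: "\<And>x. x \<in> edom h \<Longrightarrow> phival u \<le> phival x"
begin

definition centre :: "nat \<Rightarrow> 'w \<Rightarrow> 'a" where
  "centre l \<omega> = mmax_x h F s lam I B z0 (\<lambda>l j. X l j \<omega>) l"

definition values_avg :: "nat \<Rightarrow> 'w \<Rightarrow> real" where
  "values_avg l \<omega> = running_avg b (\<lambda>k. phival (iterate (centre (l - 1) \<omega>) (\<lambda>j. X l j \<omega>) (Suc k))) (I - 1)"

definition sampled_avg :: "nat \<Rightarrow> 'w \<Rightarrow> real" where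
  "sampled_avg l \<omega> = running_avg b (\<lambda>k. phival (iterate (centre (l - 1) \<omega>) (\<lambda>j. X l j \<omega>) (Suc k))
     + sample_error (centre (l - 1) \<omega>) (\<lambda>j. X l j \<omega>) (Suc k)) (I - 1)"

definition noise :: "nat \<Rightarrow> 'w \<Rightarrow> real" where
  "noise l \<omega> = noise_majorant B b (\<lambda>k. F u (X l k \<omega>) - fval u) (I - 1)"

lemma centre_0: "centre 0 = (\<lambda>_. z0)"
  by (rule ext) (simp add: centre_def)

lemma centre_Suc: "centre (Suc l) \<omega> = iterate (centre l \<omega>) (\<lambda>j. X (Suc l) j \<omega>) I"
  by (simp add: centre_def)

lemma centre_in_edom: "centre l \<omega> \<in> edom h"
  by (induction l) (auto simp: centre_0 centre_Suc z0 iterate_in_edom)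

lemma centre_measurable:
  assumes "\<And>l' j. 1 \<le> l' \<Longrightarrow> l' \<le> l \<Longrightarrow> j \<le> I \<Longrightarrow> X l' j \<in> measurable K Q"
  shows "centre l \<in> measurable K dom_space"
  using assms
proof (induction l)
  case 0
  show ?case using z0 by (auto simp: centre_0 space_restrict_space)
next
  case (Suc l)
  have "centre l \<in> measurable K dom_space" using Suc by auto
  moreover have "X (Suc l) j \<in> measurable K Q" if "j < I" for j using Suc that by auto
  ultimately show ?case
    using measurable_cut_model_iterate[of "centre l" K I "X (Suc l)"]
    unfolding centre_Suc[abs_def] by auto
qed

lemma X_measurable: "l \<in> {1..N} \<Longrightarrow> j \<le> I \<Longrightarrow> X l j \<in> measurable P Q"
  using X_indep by (force simp: P.indep_vars_def2)

text \<open>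
  The iterate of a call at step \<open>j\<close> is determined by the samples of the earlier calls and by the
  samples of the same call before step \<open>j\<close>, none of which is the sample paired with it.
\<close>

lemma is_call:
  assumes l: "l \<in> {1..N}" and dist: "integrable P (\<lambda>\<omega>. (norm (u - centre (l - 1) \<omega>))\<^sup>2)"
  shows "stochastic_call Q f h F s M lam I B P (centre (l - 1)) (X l) u"
proof -
  have joint: "distr P dom_space (\<lambda>\<omega>. iterate (centre (l - 1) \<omega>) (\<lambda>i. X l i \<omega>) j) \<Otimes>\<^sub>M Q =
      distr P (dom_space \<Otimes>\<^sub>M Q) (\<lambda>\<omega>. (iterate (centre (l - 1) \<omega>) (\<lambda>i. X l i \<omega>) j, X l j \<omega>))"
    if j: "j \<le> I" for j
  proof -
    define J where "J = {1..<l} \<times> {0..I} \<union> {l} \<times> {0..<j}"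
    have "distr P dom_space (\<lambda>\<omega>. iterate (centre (l - 1) \<omega>) (\<lambda>i. X l i \<omega>) j) \<Otimes>\<^sub>M
        distr P Q (case (l, j) of (l, j) \<Rightarrow> X l j) =
      distr P (dom_space \<Otimes>\<^sub>M Q) (\<lambda>\<omega>. (iterate (centre (l - 1) \<omega>) (\<lambda>i. X l i \<omega>) j,
        (case (l, j) of (l, j) \<Rightarrow> X l j) \<omega>))"
    proof (rule P.joint_law_determined(3)[OF X_indep])
      show "J \<subseteq> {1..N} \<times> {0..I}" "(l, j) \<in> {1..N} \<times> {0..I}" "(l, j) \<notin> J"
        using l j by (auto simp: J_def)
    next
      fix K assume "space K = space P"
        and meas: "\<And>i. i \<in> J \<Longrightarrow> (case i of (l, j) \<Rightarrow> X l j) \<in> measurable K Q"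
      have XJ: "X l' j' \<in> measurable K Q" if "(l', j') \<in> J" for l' j'
        using meas[OF that] by simp
      have "centre (l - 1) \<in> measurable K dom_space"
      proof (rule centre_measurable)
        fix l' j' assume "1 \<le> l'" "l' \<le> l - 1" "j' \<le> I"
        then have "(l', j') \<in> J" using l by (auto simp: J_def)
        then show "X l' j' \<in> measurable K Q" by (rule XJ)
      qed
      moreover have "X l i \<in> measurable K Q" if "i < j" for i
        using that by (intro XJ) (auto simp: J_def)
      ultimately show "(\<lambda>\<omega>. iterate (centre (l - 1) \<omega>) (\<lambda>i. X l i \<omega>) j) \<in> measurable K dom_space"
        using measurable_cut_model_iterate[of "centre (l - 1)" K j "X l"] by simp
    qed
    moreover have "distr P Q (X l j) = Q" using X_law l j by auto
    ultimately show ?thesis by simp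
  qed
  show ?thesis
  proof (intro stochastic_call.intro stochastic_call_axioms.intro)
    show "stochastic_composite Q f h F s M lam I" by (rule stochastic_composite_axioms)
    show "prob_space P" by (rule P.prob_space_axioms)
    show "centre (l - 1) \<in> measurable P dom_space"
      using l X_measurable by (intro centre_measurable) auto
    show "X l j \<in> measurable P Q" if "j \<le> I" for j using X_measurable l that by auto
    show "distr P Q (X l j) = Q" if "j \<le> I" for j using X_law l that by auto
    show "u \<in> edom h" by (rule u)
    show "phival u \<le> phival x" if "x \<in> edom h" for x by (rule u_min[OF that])
  qed (use joint dist in auto)
qed

lemma centre_dist: "l \<le> N \<Longrightarrow> integrable P (\<lambda>\<omega>. (norm (u - centre l \<omega>))\<^sup>2)"
proof (induction l)
  case 0
  then show ?case by (simp add: centre_0)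
next
  case (Suc l)
  interpret C: stochastic_call Q f h F s M lam I B P "centre l" "X (Suc l)" u
    using is_call[of "Suc l"] Suc by simp
  show ?case
    using C.iterate_moments[of I] by (simp add: C.Z_def centre_Suc)
qed

lemma call_value:
  assumes l: "l \<in> {1..N}"
  shows "integrable P (values_avg l)" "integrable P (sampled_avg l)"
    "(\<integral>\<omega>. sampled_avg l \<omega> \<partial>P) = (\<integral>\<omega>. values_avg l \<omega> \<partial>P)"
    "(\<integral>\<omega>. values_avg l \<omega> \<partial>P) + (\<integral>\<omega>. (norm (u - centre l \<omega>))\<^sup>2 \<partial>P) / (2 * lam)
      \<le> phival u + 2 * lam * M\<^sup>2 * (b ^ (I - 1) + (1 - b) / b) + (\<integral>\<omega>. noise l \<omega> \<partial>P)
        + (\<integral>\<omega>. (norm (u - centre (l - 1) \<omega>))\<^sup>2 \<partial>P) / (2 * lam)"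
proof -
  interpret C: stochastic_call Q f h F s M lam I B P "centre (l - 1)" "X l" u
    using l by (intro is_call centre_dist) auto
  have v: "values_avg l = (\<lambda>\<omega>. running_avg b (\<lambda>k. phival (C.Z (Suc k) \<omega>)) (I - 1))"
    by (rule ext) (simp only: values_avg_def C.Z_def)
  have w: "sampled_avg l = (\<lambda>\<omega>. running_avg b (\<lambda>k. phival (C.Z (Suc k) \<omega>) + C.err (Suc k) \<omega>) (I - 1))"
    by (rule ext) (simp only: sampled_avg_def C.Z_def C.err_def sample_error_def)
  have n: "noise l = (\<lambda>\<omega>. noise_majorant B b (\<lambda>k. C.sample_noise k \<omega>) (I - 1))"
    by (rule ext) (simp only: noise_def C.sample_noise_def)
  have c: "centre l = C.Z I"
    using l centre_Suc[of "l - 1"] by (intro ext) (simp add: C.Z_def del: One_nat_def)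
  show "integrable P (values_avg l)" "integrable P (sampled_avg l)"
    "(\<integral>\<omega>. sampled_avg l \<omega> \<partial>P) = (\<integral>\<omega>. values_avg l \<omega> \<partial>P)"
    "(\<integral>\<omega>. values_avg l \<omega> \<partial>P) + (\<integral>\<omega>. (norm (u - centre l \<omega>))\<^sup>2 \<partial>P) / (2 * lam)
      \<le> phival u + 2 * lam * M\<^sup>2 * (b ^ (I - 1) + (1 - b) / b) + (\<integral>\<omega>. noise l \<omega> \<partial>P)
        + (\<integral>\<omega>. (norm (u - centre (l - 1) \<omega>))\<^sup>2 \<partial>P) / (2 * lam)"
    unfolding v w n c using C.average_value C.average_sampled_value by auto
qed

lemma noise_le:
  assumes l: "l \<in> {1..N}" and B: "{1} \<subseteq> B" "B \<subseteq> {1..I div 2}" and \<sigma>: "0 \<le> \<sigma>"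
    and var: "card B \<noteq> 1 \<Longrightarrow> integrable Q (\<lambda>\<xi>. (F u \<xi> - fval u)\<^sup>2)"
      "card B \<noteq> 1 \<Longrightarrow> (\<integral>\<xi>. (F u \<xi> - fval u)\<^sup>2 \<partial>Q) \<le> \<sigma>\<^sup>2"
  shows "(\<integral>\<omega>. noise l \<omega> \<partial>P)
    \<le> 4 * sqrt (ln (real I + 1) / (real I + 1)) * \<sigma> * sqrt (real (card B) - 1)"
proof -
  interpret C: stochastic_call Q f h F s M lam I B P "centre (l - 1)" "X l" u
    using l by (intro is_call centre_dist) auto
  have sq: "integrable P (\<lambda>\<omega>. (C.sample_noise k \<omega>)\<^sup>2)" "(\<integral>\<omega>. (C.sample_noise k \<omega>)\<^sup>2 \<partial>P) \<le> \<sigma>\<^sup>2"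
    if "card B \<noteq> 1" "k < I" for k
    using C.integrable_of_law[of k, OF _ var(1)] var(2) that by (auto simp: C.sample_noise_def simp del: One_nat_def)
  have "(\<integral>\<omega>. noise_majorant B b (\<lambda>k. C.sample_noise k \<omega>) (I - 1) \<partial>P)
    \<le> 4 * sqrt (ln (real I + 1) / (real I + 1)) * \<sigma> * sqrt (real (card B) - 1)"
    using C.sample_noise_integrable sq
    by (intro expected_noise_le P.prob_space_axioms I B \<sigma>) auto
  then show ?thesis
    by (simp only: noise_def C.sample_noise_def)
qed

text \<open>The squared distances to \<open>u\<close> telescope over the calls.\<close>

lemma sum_values_le:
  assumes c: "\<And>l. l \<in> {1..N} \<Longrightarrow>
    2 * lam * M\<^sup>2 * (b ^ (I - 1) + (1 - b) / b) + (\<integral>\<omega>. noise l \<omega> \<partial>P) \<le> c"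
  shows "(\<Sum>l=1..N. \<integral>\<omega>. values_avg l \<omega> \<partial>P) \<le> real N * (phival u + c) + (norm (u - z0))\<^sup>2 / (2 * lam)"
proof -
  define a where "a l = (\<integral>\<omega>. (norm (u - centre l \<omega>))\<^sup>2 \<partial>P) / (2 * lam)" for l
  have "(\<Sum>l=1..n. \<integral>\<omega>. values_avg l \<omega> \<partial>P) + a n \<le> real n * (phival u + c) + a 0" if "n \<le> N" for n
    using that
  proof (induction n)
    case (Suc n)
    have "(\<integral>\<omega>. values_avg (Suc n) \<omega> \<partial>P) + a (Suc n) \<le> phival u + c + a n"
      using call_value(4)[of "Suc n"] c[of "Suc n"] Suc.prems by (simp add: a_def)
    with Suc show ?case by (simp add: algebra_simps)
  qed simp
  from this[of N] have "(\<Sum>l=1..N. \<integral>\<omega>. values_avg l \<omega> \<partial>P) + a N \<le> real N * (phival u + c) + a 0"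
    by simp
  moreover have "0 \<le> a N" using lam by (simp add: a_def)
  moreover have "a 0 = (norm (u - z0))\<^sup>2 / (2 * lam)"
    by (simp add: a_def centre_0 P.prob_space)
  ultimately show ?thesis by simp
qed

lemma mmax_wa_eq:
  "mmax_wa h F s lam I N B z0 (\<lambda>l j. X l j \<omega>) = ereal (1 / real N * (\<Sum>l=1..N. sampled_avg l \<omega>))"
proof -
  have "mmax_w h F s lam I B z0 (\<lambda>l j. X l j \<omega>) l = ereal (sampled_avg l \<omega>)" for l
  proof -
    have "Suc (I - 1) = I" using I by simp
    then show ?thesis
      using smax_u_eq[OF centre_in_edom, of "l - 1" \<omega> "\<lambda>j. X l j \<omega>" "I - 1"]
      by (simp add: mmax_w_def sampled_avg_def centre_def)
  qed
  then show ?thesis by (simp add: mmax_wa_def)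
qed

text \<open>Jensen's inequality, within a call for \<open>smax_za_value\<close> and here across the calls.\<close>

lemma mmax_ya_le:
  assumes N: "1 \<le> N"
  shows "phi f h (mmax_ya h F s lam I N B z0 (\<lambda>l j. X l j \<omega>))
    \<le> ereal (1 / real N * (\<Sum>l=1..N. values_avg l \<omega>))"
proof -
  define y where "y l = mmax_y h F s lam I B z0 (\<lambda>l j. X l j \<omega>) l" for l
  have y: "y l \<in> edom h" "phival (y l) \<le> values_avg l \<omega>" for l
  proof -
    have "Suc (I - 1) = I" using I by simp
    then show "y l \<in> edom h" "phival (y l) \<le> values_avg l \<omega>"
      using smax_za_value[OF centre_in_edom, of "l - 1" \<omega> "\<lambda>j. X l j \<omega>" "I - 1"]
      by (auto simp: y_def mmax_y_def values_avg_def centre_def)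
  qed
  have ya: "mmax_ya h F s lam I N B z0 (\<lambda>l j. X l j \<omega>) = (\<Sum>l=1..N. (1 / real N) *\<^sub>R y l)"
    by (simp add: mmax_ya_def y_def scaleR_sum_right)
  have weights: "(\<Sum>l=1..N. 1 / real N) = 1" using N by simp
  have "(\<Sum>l=1..N. (1 / real N) *\<^sub>R y l) \<in> edom h"
    using convex_on_phival y weights
    by (intro convex_sum) (auto simp: convex_on_def)
  moreover have "phival (\<Sum>l=1..N. (1 / real N) *\<^sub>R y l) \<le> (\<Sum>l=1..N. 1 / real N * phival (y l))"
    using N weights y by (intro convex_on_sum[OF _ _ convex_on_phival]) auto
  moreover have "(\<Sum>l=1..N. 1 / real N * phival (y l)) \<le> (\<Sum>l=1..N. 1 / real N * values_avg l \<omega>)"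
    using y by (intro sum_mono mult_left_mono) auto
  ultimately show ?thesis
    unfolding ya by (simp add: phival sum_distrib_left)
qed

lemma expect_outputs:
  assumes N: "1 \<le> N"
  shows "expect P (\<lambda>\<omega>. phi f h (mmax_ya h F s lam I N B z0 (\<lambda>l j. X l j \<omega>)))
      \<le> expect P (\<lambda>\<omega>. mmax_wa h F s lam I N B z0 (\<lambda>l j. X l j \<omega>))" (is ?le)
    and "expect P (\<lambda>\<omega>. mmax_wa h F s lam I N B z0 (\<lambda>l j. X l j \<omega>))
      = ereal (1 / real N * (\<Sum>l=1..N. \<integral>\<omega>. values_avg l \<omega> \<partial>P))" (is ?eq)
proof -
  have v: "integrable P (\<lambda>\<omega>. 1 / real N * (\<Sum>l=1..N. values_avg l \<omega>))"
    and w: "integrable P (\<lambda>\<omega>. 1 / real N * (\<Sum>l=1..N. sampled_avg l \<omega>))"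
    by (intro integrable_mult_right Bochner_Integration.integrable_sum call_value; assumption)+
  have "(\<integral>\<omega>. 1 / real N * (\<Sum>l=1..N. sampled_avg l \<omega>) \<partial>P) = 1 / real N * (\<Sum>l=1..N. \<integral>\<omega>. values_avg l \<omega> \<partial>P)"
    using call_value(2,3) by simp
  then show ?eq
    unfolding mmax_wa_eq using expect_integrable[OF w] by simp
  moreover have "(\<integral>\<omega>. 1 / real N * (\<Sum>l=1..N. values_avg l \<omega>) \<partial>P) = 1 / real N * (\<Sum>l=1..N. \<integral>\<omega>. values_avg l \<omega> \<partial>P)"
    using call_value(1) by simp
  then have "expect P (\<lambda>\<omega>. ereal (1 / real N * (\<Sum>l=1..N. values_avg l \<omega>)))
      = ereal (1 / real N * (\<Sum>l=1..N. \<integral>\<omega>. values_avg l \<omega> \<partial>P))"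
    using expect_integrable[OF v] by simp
  moreover have "expect P (\<lambda>\<omega>. phi f h (mmax_ya h F s lam I N B z0 (\<lambda>l j. X l j \<omega>)))
      \<le> expect P (\<lambda>\<omega>. ereal (1 / real N * (\<Sum>l=1..N. values_avg l \<omega>)))"
    by (intro expect_mono mmax_ya_le N)
  ultimately show ?le by simp
qed

end


section \<open>Minimizers and the variance at a point\<close>

text \<open>Closedness guarantees that the minimizer closest to a given point exists.\<close>

lemma closed_minimizers:
  fixes f h :: "'a::euclidean_space \<Rightarrow> ereal"
  assumes f: "proper_closed_convex f" and h: "proper_closed_convex h"
  shows "closed (minimizers f h)"
proof -
  have sub: "closed {x. f x + h x \<le> c}" for c
  proof -
    \<comment> \<open>the sum exceeds \<open>c\<close> exactly where \<open>f\<close> and \<open>h\<close> exceed numbers with sum at least \<open>c\<close>\<close>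
    have "- {x. f x + h x \<le> c} = (\<Union>(p, q) \<in> {(p, q). c \<le> ereal (p + q)}. - {x. f x \<le> ereal p} \<inter> - {x. h x \<le> ereal q})"
    proof (intro set_eqI iffI)
      fix x assume "x \<in> - {x. f x + h x \<le> c}"
      then have less: "c < f x + h x" by auto
      then obtain r where r: "c \<le> ereal r" "ereal r < f x + h x"
        by (metis ereal_dense2 less_imp_le)
      have nm: "f x \<noteq> -\<infinity>" "h x \<noteq> -\<infinity>"
        using f h by (auto simp: proper_closed_convex_def)
      have "\<exists>p q. r \<le> p + q \<and> ereal p < f x \<and> ereal q < h x"
      proof (cases "f x"; cases "h x")
        fix a b assume ab: "f x = ereal a" "h x = ereal b"
        then show ?thesis using r
          by (intro exI[of _ "a - (a + b - r) / 2"] exI[of _ "b - (a + b - r) / 2"]) (auto simp: field_simps)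
      next
        fix a assume "f x = ereal a" "h x = \<infinity>"
        then show ?thesis by (intro exI[of _ "a - 1"] exI[of _ "r - (a - 1)"]) auto
      next
        fix b assume "f x = \<infinity>" "h x = ereal b"
        then show ?thesis by (intro exI[of _ "r - (b - 1)"] exI[of _ "b - 1"]) auto
      next
        assume "f x = \<infinity>" "h x = \<infinity>"
        then show ?thesis by (intro exI[of _ r] exI[of _ 0]) auto
      qed (use nm in auto)
      then obtain p q where "r \<le> p + q" "ereal p < f x" "ereal q < h x" by auto
      moreover from this r have "c \<le> ereal (p + q)" by (meson ereal_less_eq(3) order_trans)
      ultimately show "x \<in> (\<Union>(p, q) \<in> {(p, q). c \<le> ereal (p + q)}. - {x. f x \<le> ereal p} \<inter> - {x. h x \<le> ereal q})"
        by (auto simp: not_le)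
    next
      fix x assume "x \<in> (\<Union>(p, q) \<in> {(p, q). c \<le> ereal (p + q)}. - {x. f x \<le> ereal p} \<inter> - {x. h x \<le> ereal q})"
      then obtain p q where pq: "c \<le> ereal (p + q)" "ereal p < f x" "ereal q < h x"
        by (auto simp: not_le)
      then have "ereal p + ereal q < f x + h x"
        by (intro ereal_add_strict_mono2)
      with pq show "x \<in> - {x. f x + h x \<le> c}" by auto
    qed
    moreover have "open \<dots>"
      using closed_sublevel_pcc[OF f] closed_sublevel_pcc[OF h] by (auto intro!: open_UN open_Int)
    ultimately show ?thesis by (simp add: closed_def)
  qed
  have "minimizers f h = (\<Inter>y. {x. f x + h x \<le> phi f h y})"
    by (auto simp: minimizers_def phi_def)
  then show ?thesis using sub by auto
qed

context stochastic_composite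
begin

lemma minimizer_facts:
  assumes x: "x \<in> minimizers f h" and z: "z \<in> edom h"
  shows "x \<in> edom h" "y \<in> edom h \<Longrightarrow> phival x \<le> phival y" "phi_opt f h = ereal (phival x)"
proof -
  have le: "phi f h x \<le> phi f h y" for y using x by (simp add: minimizers_def)
  have "f x \<noteq> -\<infinity>" using f by (simp add: proper_closed_convex_def)
  then show x_dom: "x \<in> edom h"
    using le[of z] phival[OF z] by (cases "h x"; cases "f x") (auto simp: edom_def phi_def)
  show "phival x \<le> phival y" if "y \<in> edom h"
    using le[of y] phival that x_dom by simp
  have "phi_opt f h = phi f h x"
    unfolding phi_opt_def using le by (intro antisym INF_lower INF_greatest) auto
  then show "phi_opt f h = ereal (phival x)" using phival x_dom by simp
qed

lemma sigma_cases:
  assumes u: "u \<in> edom h"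
  obtains "sigma Q f h F u = \<infinity>"
  | \<sigma> where "0 \<le> \<sigma>" "sigma Q f h F u = ereal \<sigma>" "integrable Q (\<lambda>\<xi>. (F u \<xi> - fval u)\<^sup>2)"
      "(\<integral>\<xi>. (F u \<xi> - fval u)\<^sup>2 \<partial>Q) = \<sigma>\<^sup>2"
proof -
  note [measurable] = F_section[OF u]
  let ?e = "\<integral>\<^sup>+\<xi>. ennreal ((F u \<xi> - fval u)\<^sup>2) \<partial>Q"
  have "(Phi h F u \<xi> - phi f h u)\<^sup>2 = ereal ((F u \<xi> - fval u)\<^sup>2)" for \<xi>
    by (simp add: Phi_def phi_def fval[OF u] hval[OF u])
  then have sigma: "sigma Q f h F u = ereal_sqrt (enn2ereal ?e)"
    by (simp add: sigma_def expect_nonneg)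
  show ?thesis
  proof (cases ?e)
    case top
    then show ?thesis using that(1) sigma by (simp add: ereal_sqrt_def)
  next
    case (real r)
    have int: "integrable Q (\<lambda>\<xi>. (F u \<xi> - fval u)\<^sup>2)"
      using real by (intro integrableI_nonneg) auto
    have "(\<integral>\<xi>. (F u \<xi> - fval u)\<^sup>2 \<partial>Q) = r"
      using real nn_integral_eq_integral[OF int] by simp
    then show ?thesis
      using that(2)[of "sqrt r"] real sigma int by (simp add: ereal_sqrt_def)
  qed
qed

end

text \<open>
  The step size balances the two error terms: \<open>D\<^sup>2 / (2 \<lambda> N)\<close> from the initial distance equals half of
  the bound, and the price of the steps, at most \<open>14 t \<lambda> M\<^sup>2\<close> with \<open>t = ln (I + 1) / (I + 1)\<close>,
  fits into the other half, which could hold \<open>44 t \<lambda> M\<^sup>2\<close>.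
\<close>

lemma step_size_balance:
  fixes M D lam t :: real and I N :: nat
  assumes pos: "0 < M" "0 < D" "1 \<le> N" "2 \<le> I"
  defines "t \<equiv> ln (real I + 1) / (real I + 1)"
  assumes lam: "lam = D * sqrt (real I + 1) / (2 * M * sqrt (22 * real N * ln (real I + 1)))"
    and d: "0 \<le> d" "d \<le> D"
  shows "0 < lam"
    and "14 * t * lam * M\<^sup>2 + d\<^sup>2 / (2 * lam * real N) \<le> 2 * sqrt t * (sqrt 22 * M * D / sqrt (real N))"
proof -
  have t: "0 < t" using beta_bounds(5)[OF pos(4)] by (simp add: t_def)
  define q where "q = sqrt (22 * real N * t)"
  have q: "0 < q" using t pos by (simp add: q_def)
  have q2: "q * q = 22 * real N * t" using t by (simp add: q_def)
  have N: "0 < real N" using pos by simp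
  have L: "sqrt (22 * real N * ln (real I + 1)) = q * sqrt (real I + 1)"
    by (simp add: q_def t_def flip: real_sqrt_mult)
  have lam_eq: "lam = D / (2 * M * q)"
    unfolding lam L using pos q by (simp add: field_simps)
  then show "0 < lam" using pos q by simp
  have "14 * t * lam * M\<^sup>2 = 7 * t * M * D / q"
    using pos q by (simp add: lam_eq field_simps power2_eq_square)
  also have "\<dots> \<le> 22 * t * M * D / q"
    using pos q t by (intro divide_right_mono mult_right_mono) auto
  also have "\<dots> = M * D * q / real N"
    using q2 q N by (simp add: field_simps)
  finally have 1: "14 * t * lam * M\<^sup>2 \<le> M * D * q / real N" .
  have "d\<^sup>2 / (2 * lam * real N) \<le> D\<^sup>2 / (2 * lam * real N)"
    using d N \<open>0 < lam\<close> by (intro divide_right_mono power_mono) auto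
  also have "\<dots> = M * D * q / real N"
    using pos q by (simp add: lam_eq field_simps power2_eq_square)
  finally have 2: "d\<^sup>2 / (2 * lam * real N) \<le> M * D * q / real N" .
  have "q / real N = sqrt t * sqrt 22 / sqrt (real N)"
    using N by (simp add: q_def real_sqrt_mult field_simps)
  then have "2 * sqrt t * (sqrt 22 * M * D / sqrt (real N)) = 2 * (M * D * (q / real N))"
    by simp
  also have "\<dots> = M * D * q / real N + M * D * q / real N" by simp
  finally show "14 * t * lam * M\<^sup>2 + d\<^sup>2 / (2 * lam * real N) \<le> 2 * sqrt t * (sqrt 22 * M * D / sqrt (real N))"
    using add_mono[OF 1 2] by (simp only:)
qed



theorem theorem4p2:
  fixes f h :: "real ^ 'n \<Rightarrow> ereal"
    and Q :: "'b measure"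
    and F :: "real ^ 'n \<Rightarrow> 'b \<Rightarrow> real"
    and s :: "real ^ 'n \<Rightarrow> 'b \<Rightarrow> real ^ 'n"
    and \<Omega> :: "'w measure"
    and X :: "nat \<Rightarrow> nat \<Rightarrow> 'w \<Rightarrow> 'b"
    and M D lam :: real
    and N I :: nat
    and B :: "nat set"
    and z0 xstar :: "real ^ 'n"
  assumes f: "proper_closed_convex f"
    and h: "proper_closed_convex h"
    and dom: "edom h \<subseteq> edom f"
    and Q: "prob_space Q"
    and F_measurable:
      "(\<lambda>(x, \<xi>). F x \<xi>) \<in> borel_measurable (restrict_space borel (edom h) \<Otimes>\<^sub>M Q)"
    and s_measurable:
      "(\<lambda>(x, \<xi>). s x \<xi>) \<in> borel_measurable (restrict_space borel (edom h) \<Otimes>\<^sub>M Q)"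
    and F_convex: "AE \<xi> in Q. convex_on (edom h) (\<lambda>x. F x \<xi>)"
    and f_eq: "\<forall>x\<in>edom h. f x = expect Q (\<lambda>\<xi>. ereal (F x \<xi>))"
    and s_subgradient:
      "AE \<xi> in Q. \<forall>x\<in>edom h. \<forall>u\<in>edom h. F u \<xi> \<ge> F x \<xi> + s x \<xi> \<bullet> (u - x)"
    and M: "ereal M = noise_bound Q h s"
    and M_pos: "M > 0"
    and minimizers: "minimizers f h \<noteq> {}"
    and \<Omega>: "prob_space \<Omega>"
    and X_indep:
      "prob_space.indep_vars \<Omega> (\<lambda>_. Q) (\<lambda>(l, j). X l j) ({1..N} \<times> {0..I})"
    and X_law: "\<forall>l\<in>{1..N}. \<forall>j\<in>{0..I}. distr \<Omega> Q (X l j) = Q"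
    and N: "N \<ge> 1"
    and I: "I \<ge> 2"
    and B: "{1} \<subseteq> B" "B \<subseteq> {1..I div 2}"
    and z0: "z0 \<in> edom h"
    and xstar: "xstar = closest_point (minimizers f h) z0"
    and D: "D \<ge> norm (z0 - xstar)"
    and D_pos: "D > 0"
    and lam: "lam = D * sqrt (real I + 1) / (2 * M * sqrt (22 * real N * ln (real I + 1)))"
  shows
    "expect \<Omega> (\<lambda>\<omega>. phi f h (mmax_ya h F s lam I N B z0 (\<lambda>l j. X l j \<omega>))) - phi_opt f h
       \<le> expect \<Omega> (\<lambda>\<omega>. mmax_wa h F s lam I N B z0 (\<lambda>l j. X l j \<omega>)) - phi_opt f h
     \<and> expect \<Omega> (\<lambda>\<omega>. mmax_wa h F s lam I N B z0 (\<lambda>l j. X l j \<omega>)) - phi_opt f h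
       \<le> ereal (2 * sqrt (ln (real I + 1)) / sqrt (real I + 1)) *
          (ereal (sqrt 22 * M * D / sqrt (real N))
            + 2 * sigma Q f h F xstar * ereal (sqrt (real (card B) - 1)))"
proof -
  have t_eq: "sqrt (ln (real I + 1)) / sqrt (real I + 1) = sqrt (ln (real I + 1) / (real I + 1))"
    by (simp add: real_sqrt_divide)
  define t where "t = ln (real I + 1) / (real I + 1)"
  define d where "d = norm (xstar - z0)"
  have d: "0 \<le> d" "d \<le> D" using D by (auto simp: d_def norm_minus_commute)
  note balance = step_size_balance[OF M_pos D_pos N I lam d, folded t_def]
  note t = beta_bounds(5)[OF I, folded t_def]
  interpret stochastic_composite Q f h F s M lam I B
    using Q f h dom F_measurable s_measurable f_eq s_subgradient M M_pos balance(1) I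
    by (intro stochastic_composite.intro stochastic_composite_axioms.intro)
  have "xstar \<in> minimizers f h"
    unfolding xstar using closed_minimizers[OF f h] minimizers by (rule closest_point_in_set)
  note xs = minimizer_facts[OF this z0]
  interpret R: stochastic_restarts Q f h F s M lam I B \<Omega> X N z0 xstar
    using \<Omega> X_indep X_law z0 xs
    by (intro stochastic_restarts.intro stochastic_restarts_axioms.intro stochastic_composite_axioms) auto
  have card: "1 \<le> card B"
    using B finite_subset[OF B(2)] by (auto simp: Suc_le_eq card_gt_0_iff)
  have mean_le: "1 / real N * (\<Sum>l=1..N. \<integral>\<omega>. R.values_avg l \<omega> \<partial>\<Omega>) - phival xstar
      \<le> 2 * sqrt t * (sqrt 22 * M * D / sqrt (real N) + 2 * \<sigma> * sqrt (real (card B) - 1))"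
    if \<sigma>: "0 \<le> \<sigma>" and var: "card B \<noteq> 1 \<Longrightarrow> integrable Q (\<lambda>\<xi>. (F xstar \<xi> - fval xstar)\<^sup>2)"
      "card B \<noteq> 1 \<Longrightarrow> (\<integral>\<xi>. (F xstar \<xi> - fval xstar)\<^sup>2 \<partial>Q) \<le> \<sigma>\<^sup>2" for \<sigma>
  proof -
    define e where "e = 4 * sqrt t * \<sigma> * sqrt (real (card B) - 1)"
    have "beta I ^ (I - 1) + (1 - beta I) / beta I \<le> 7 * t"
      using beta_powers(1)[OF I] beta_bounds(4)[OF I] by (simp add: t_def)
    then have "2 * lam * M\<^sup>2 * (beta I ^ (I - 1) + (1 - beta I) / beta I) \<le> 2 * lam * M\<^sup>2 * (7 * t)"
      using balance(1) by (intro mult_left_mono) auto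
    also have "\<dots> = 14 * t * lam * M\<^sup>2" by simp
    finally have "2 * lam * M\<^sup>2 * (beta I ^ (I - 1) + (1 - beta I) / beta I) \<le> 14 * t * lam * M\<^sup>2" .
    moreover have "(\<integral>\<omega>. R.noise l \<omega> \<partial>\<Omega>) \<le> e" if "l \<in> {1..N}" for l
      using R.noise_le[OF that B \<sigma> var] by (simp add: e_def t_def)
    ultimately have "(\<Sum>l=1..N. \<integral>\<omega>. R.values_avg l \<omega> \<partial>\<Omega>)
        \<le> real N * (phival xstar + (14 * t * lam * M\<^sup>2 + e)) + d\<^sup>2 / (2 * lam)"
      unfolding d_def by (intro R.sum_values_le add_mono)
    then have "1 / real N * (\<Sum>l=1..N. \<integral>\<omega>. R.values_avg l \<omega> \<partial>\<Omega>)
        \<le> 1 / real N * (real N * (phival xstar + (14 * t * lam * M\<^sup>2 + e)) + d\<^sup>2 / (2 * lam))"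
      by (intro mult_left_mono) auto
    also have "\<dots> = phival xstar + (14 * t * lam * M\<^sup>2 + e) + d\<^sup>2 / (2 * lam * real N)"
      using N balance(1) by (simp add: field_simps)
    finally have "1 / real N * (\<Sum>l=1..N. \<integral>\<omega>. R.values_avg l \<omega> \<partial>\<Omega>) - phival xstar
        \<le> 2 * sqrt t * (sqrt 22 * M * D / sqrt (real N)) + e"
      using balance(2) by linarith
    then show ?thesis by (simp add: e_def algebra_simps)
  qed
  have factor: "ereal (2 * sqrt (ln (real I + 1)) / sqrt (real I + 1)) = ereal (2 * sqrt t)"
    using t_eq by (simp add: t_def)
  have upper: "ereal (1 / real N * (\<Sum>l=1..N. \<integral>\<omega>. R.values_avg l \<omega> \<partial>\<Omega>) - phival xstar)
      \<le> ereal (2 * sqrt t) * (ereal (sqrt 22 * M * D / sqrt (real N))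
            + 2 * sigma Q f h F xstar * ereal (sqrt (real (card B) - 1)))"
  proof (cases "card B = 1")
    case True
    \<comment> \<open>the variance may be infinite here, but its factor in the bound is zero\<close>
    then show ?thesis using mean_le[of 0] by (simp flip: zero_ereal_def)
  next
    case False
    with card have pos: "0 < sqrt (real (card B) - 1)" by simp
    show ?thesis
    proof (cases rule: sigma_cases[OF xs(1)])
      case 1
      then show ?thesis using pos t by simp
    next
      case (2 \<sigma>)
      then show ?thesis using mean_le[of \<sigma>] by simp
    qed
  qed
  show ?thesis
    unfolding factor xs(3)
    using R.expect_outputs(1)[OF N] upper
    by (intro conjI ereal_minus_mono order_refl) (simp_all only: R.expect_outputs(2)[OF N] ereal_minus)
qed

end
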